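(* Let $\lambda_1,\lambda,\alpha,\beta>0$, let $N_1$ be a Poisson process with intensity $\lambda_1$, and let $G_N(t)=G(N(t))$, $t\ge0$, be the compound Poisson-Gamma subordinator with parameters $\lambda,\alpha,\beta$, independent of $N_1$. For an integer $k\ge1$ let $\tilde T_k=\inf\{s\ge0:N_1(G_N(s))\ge k\}$. Then $\tilde T_k$ has density, for $s>0$, $$P\{\tilde T_k\in ds\}/ds=e^{-\lambda s}\sum_{j=k}^{\infty}\left(\frac{\lambda_1}{\lambda_1+\beta}\right)^j\frac{1}{j!}\sum_{n=1}^{\infty}s^{n-1}(n-\lambda s)\left(\frac{\lambda\beta^{\alpha}}{(\lambda_1+\beta)^{\alpha}}\right)^n\frac{\Gamma(\alpha n+j)}{n!\,\Gamma(\alpha n)}.$$ In the case $\alpha=1$, where $G_N$ is denoted $E_N$ and $\tilde T_k$ is denoted $\tilde T_k^E$, one has for $s>0$ $$P\{\tilde T_k^E\in ds\}/ds=e^{-\lambda s}\frac{\lambda\beta}{\lambda_1+\beta}\sum_{j=k}^{\infty}\frac{\lambda_1^j}{(\lambda_1+\beta)^j}\left[\mathcal{E}_{1,1}^{j+1}\left(\frac{\lambda\beta s}{\lambda_1+\beta}\right)-\lambda s\,\mathcal{E}_{1,2}^{j+1}\left(\frac{\lambda\beta s}{\lambda_1+\beta}\right)\right].$$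
   Context: The Gamma process $G$ with parameters $(\alpha,\beta)$ is the subordinator with $E e^{-uG(t)}=(1+u/\beta)^{-\alpha t}$. The compound Poisson-Gamma subordinator with parameters $\lambda,\alpha,\beta$ is $G_N(t)=G(N(t))$, where $N$ is a Poisson process with intensity $\lambda$ independent of $G$. The three-parameter generalized Mittag-Leffler function is $$\mathcal{E}_{\rho,\delta}^{\gamma}(z)=\sum_{k=0}^{\infty}\frac{\Gamma(\gamma+k)}{\Gamma(\gamma)}\frac{z^k}{k!\,\Gamma(\rho k+\delta)},$$ for $z,\rho,\delta,\gamma\in\mathbb{C}$ with $\mathrm{Re}(\rho),\mathrm{Re}(\delta),\mathrm{Re}(\gamma)>0$. *)

theory Defs
  imports "HOL-Probability.Probability"
begin

text \<open>
  Processes are indexed by real times, of which only the times in \<^term>\<open>{0::real..}\<close> matter.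
  Path properties are required of every path, not just almost surely, so that composed processes
  and first passage times are measurable without completing the probability space.
\<close>

context prob_space
begin

text \<open>
  Stochastic continuity is not listed separately: it follows from right continuity of the paths
  and stationarity of the increments.
\<close>

definition levy_process :: "(real \<Rightarrow> 'a \<Rightarrow> real) \<Rightarrow> bool" where
  "levy_process X \<longleftrightarrow>
     (\<forall>t\<ge>0. random_variable borel (X t)) \<and>
     (\<forall>\<omega>\<in>space M. X 0 \<omega> = 0) \<and>
     (\<forall>(n::nat) \<tau>. 0 \<le> \<tau> 0 \<and> mono_on {..n} \<tau> \<longrightarrow>
        indep_vars (\<lambda>_. borel) (\<lambda>i \<omega>. X (\<tau> (Suc i)) \<omega> - X (\<tau> i) \<omega>) {..<n}) \<and>
     (\<forall>s\<ge>0. \<forall>t\<ge>0. distr M borel (\<lambda>\<omega>. X (s + t) \<omega> - X s \<omega>) = distr M borel (X t)) \<and>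
     (\<forall>\<omega>\<in>space M. \<forall>t\<ge>0. continuous (at_right t) (\<lambda>s. X s \<omega>)) \<and>
     (\<forall>\<omega>\<in>space M. \<forall>t>0. \<exists>l. ((\<lambda>s. X s \<omega>) \<longlongrightarrow> l) (at_left t))"

definition subordinator :: "(real \<Rightarrow> 'a \<Rightarrow> real) \<Rightarrow> bool" where
  "subordinator X \<longleftrightarrow> levy_process X \<and> (\<forall>\<omega>\<in>space M. mono_on {0..} (\<lambda>t. X t \<omega>))"

definition poisson_process :: "real \<Rightarrow> (real \<Rightarrow> 'a \<Rightarrow> nat) \<Rightarrow> bool" where
  "poisson_process r N \<longleftrightarrow>
     subordinator (\<lambda>t \<omega>. real (N t \<omega>)) \<and>
     (\<forall>t\<ge>0. \<forall>n. prob {\<omega> \<in> space M. N t \<omega> = n} = (r * t) ^ n / fact n * exp (- (r * t)))"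

definition gamma_process :: "real \<Rightarrow> real \<Rightarrow> (real \<Rightarrow> 'a \<Rightarrow> real) \<Rightarrow> bool" where
  "gamma_process \<alpha> \<beta> G \<longleftrightarrow>
     subordinator G \<and>
     (\<forall>t\<ge>0. \<forall>u\<ge>0. expectation (\<lambda>\<omega>. exp (- u * G t \<omega>)) = (1 + u / \<beta>) powr (- \<alpha> * t))"

text \<open>
  Independence of whole processes: the path maps, taken into the product space over all times
  (whose sets are generated by the finite-dimensional cylinders), are independent.
\<close>

definition indep_processes :: "(real \<Rightarrow> 'a \<Rightarrow> real) \<Rightarrow> (real \<Rightarrow> 'a \<Rightarrow> real) \<Rightarrow> bool" where
  "indep_processes X Y \<longleftrightarrow>
     indep_var (PiM {0..} (\<lambda>_. borel)) (\<lambda>\<omega>. \<lambda>t\<in>{0..}. X t \<omega>)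
               (PiM {0..} (\<lambda>_. borel)) (\<lambda>\<omega>. \<lambda>t\<in>{0..}. Y t \<omega>)"

end

definition time_change :: "(real \<Rightarrow> 'a \<Rightarrow> 'b) \<Rightarrow> (real \<Rightarrow> 'a \<Rightarrow> real) \<Rightarrow> real \<Rightarrow> 'a \<Rightarrow> 'b" where
  "time_change X S = (\<lambda>t \<omega>. X (S t \<omega>) \<omega>)"

text \<open>The infimum is taken in \<^typ>\<open>ereal\<close>, so it is \<^term>\<open>\<infinity>::ereal\<close> if the level is never reached.\<close>

definition first_passage_time :: "(real \<Rightarrow> 'a \<Rightarrow> nat) \<Rightarrow> nat \<Rightarrow> 'a \<Rightarrow> ereal" where
  "first_passage_time X k \<omega> = (INF s\<in>{s. 0 \<le> s \<and> k \<le> X s \<omega>}. ereal s)"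

text \<open>
  The class \<^class>\<open>Gamma\<close> has the instances \<^typ>\<open>real\<close> and \<^typ>\<open>complex\<close>. The series converges for
  all \<open>z\<close> if \<open>\<rho>\<close>, \<open>\<delta>\<close>, \<open>\<gamma>\<close> have positive real part.
\<close>

definition mittag_leffler3 :: "'a::Gamma \<Rightarrow> 'a \<Rightarrow> 'a \<Rightarrow> 'a \<Rightarrow> 'a" where
  "mittag_leffler3 \<rho> \<delta> \<gamma> z =
     (\<Sum>k. Gamma (\<gamma> + of_nat k) / Gamma \<gamma> * (z ^ k / (fact k * Gamma (\<rho> * of_nat k + \<delta>))))"

lemma mittag_leffler3_complex_of_real:
  fixes \<rho> \<delta> \<gamma> z :: real
  assumes "summable (\<lambda>k. Gamma (\<gamma> + of_nat k) / Gamma \<gamma> * (z ^ k / (fact k * Gamma (\<rho> * of_nat k + \<delta>))))"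
  shows "mittag_leffler3 (complex_of_real \<rho>) (of_real \<delta>) (of_real \<gamma>) (of_real z) =
         of_real (mittag_leffler3 \<rho> \<delta> \<gamma> z)"
  unfolding mittag_leffler3_def suminf_of_real[OF assms]
  by (simp flip: Gamma_complex_of_real)

end

(*
  The process N\<^sub>1(G\<^sub>N(s)) is nondecreasing and locally constant to the right, so T \<le> s holds exactly if
  N\<^sub>1(G\<^sub>N(s)) \<ge> k. Conditioning on N(s) = n gives P(T \<le> s) = \<Sum>n. p(n) * w(n), where p(n) is the Poisson
  weight with mean lam * s and w(n) = P(N\<^sub>1(G(n)) \<ge> k). Expanding the Laplace transform of G(n) at
  (1 - z) * lam\<^sub>1 as a power series in z shows that N\<^sub>1(G(n)) is negative binomial. Termwise
  differentiation in s yields the density lam * (\<Sum>n. p(n) * (w(n+1) - w(n))), which is nonnegative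
  because w is nondecreasing; writing w(n) as a sum over the levels j \<ge> k and exchanging the two
  absolutely convergent sums gives the stated double series.
*)
theory Submission
  imports Defs
begin

subsection \<open>Series\<close>

text \<open>The one-dimensional laws of \<open>G\<close> are given by Laplace transforms, so no
  Gamma density is integrated: laws are identified through generating functions on |z| < 1. The
  delicate point is to evaluate \<open>N\<^sub>1\<close> at the random time
  \<open>G\<^sub>N s\<close>. A countable decomposition handles only random times with countably
  many values, so the time is rounded up to a dyadic grid and right continuity of the paths restores
  the limit. The factor n - \<lambda> s stems from summation by parts: since w(0) = 0, the sum of
  p(n) * (w(n+1) - w(n)) over all n equals the sum of (p(n-1) - p(n)) * w(n) over n \<ge> 1, and
  with x = \<lambda> s the difference p(n-1) - p(n) is exp(-x) * x^(n-1) * (n - x) / n!. This signed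
  form expands into the double series, whereas the form with differences of w shows the sign of the
  density. As a real number, an infinite passage time is read as 0. It must therefore be shown that
  the distribution function tends to 1; otherwise an atom at 0 could remain.\<close>

lemma summable_on_product_weighted:
  fixes d :: "'i \<Rightarrow> real" and m :: "'i \<Rightarrow> 'j \<Rightarrow> real"
  assumes d: "(\<lambda>n. \<bar>d n\<bar>) summable_on I"
    and m0: "\<And>n j. n \<in> I \<Longrightarrow> j \<in> J \<Longrightarrow> 0 \<le> m n j"
    and m: "\<And>n. n \<in> I \<Longrightarrow> (m n has_sum w n) J"
    and w: "\<And>n. n \<in> I \<Longrightarrow> w n \<le> 1"
  shows "j \<in> J \<Longrightarrow> (\<lambda>n. d n * m n j) summable_on I"
    and "(\<lambda>j. \<Sum>\<^sub>\<infinity>n\<in>I. d n * m n j) summable_on J"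
    and "(\<Sum>\<^sub>\<infinity>j\<in>J. \<Sum>\<^sub>\<infinity>n\<in>I. d n * m n j) = (\<Sum>\<^sub>\<infinity>n\<in>I. d n * w n)"
proof -
  have w0: "0 \<le> w n" if "n \<in> I" for n
    using has_sum_nonneg[OF m[OF that]] m0 that by blast
  have norm_m: "((\<lambda>j. norm (d n * m n j)) has_sum (\<bar>d n\<bar> * w n)) J" if "n \<in> I" for n
  proof -
    have "((\<lambda>j. \<bar>d n\<bar> * m n j) has_sum (\<bar>d n\<bar> * w n)) J"
      by (intro has_sum_cmult_right m that)
    then show ?thesis
      by (rule has_sum_cong[THEN iffD1, rotated]) (simp add: abs_mult m0 that)
  qed
  \<comment> \<open>The sum of all absolute values is the sum of |d n| * w n, hence at most the sum
    of |d n|. Absolute summability over the product gives all three claims.\<close>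
  have "(\<lambda>x. norm ((\<lambda>(n, j). d n * m n j) x)) summable_on I \<times> J"
    unfolding Infinite_Sum.abs_summable_on_Sigma_iff
  proof (intro conjI ballI)
    fix n assume "n \<in> I"
    then show "(\<lambda>j. norm (case (n, j) of (n, j) \<Rightarrow> d n * m n j)) summable_on J"
      using norm_m has_sum_imp_summable by fastforce
  next
    have "(\<lambda>n. \<bar>d n\<bar> * w n) summable_on I"
      using w w0 by (intro summable_on_comparison_test[OF d]) (auto intro!: mult_left_le)
    then have "(\<lambda>n. norm (\<Sum>\<^sub>\<infinity>j\<in>J. norm (d n * m n j))) summable_on I"
      by (rule summable_on_cong[THEN iffD1, rotated])
        (use norm_m[THEN infsumI] w0 in \<open>simp add: abs_mult\<close>)
    then show "(\<lambda>n. norm (\<Sum>\<^sub>\<infinity>j\<in>J. norm (case (n, j) of (n, j) \<Rightarrow> d n * m n j))) summable_on I"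
      by simp
  qed
  then have prod: "(\<lambda>(n, j). d n * m n j) summable_on I \<times> J"
    by (rule Infinite_Sum.abs_summable_summable)
  then have swapped: "(\<lambda>(j, n). d n * m n j) summable_on J \<times> I"
    by (subst (asm) summable_on_swap) (simp add: case_prod_unfold)
  show "j \<in> J \<Longrightarrow> (\<lambda>n. d n * m n j) summable_on I"
    using summable_on_SigmaD1[OF swapped] by simp
  show "(\<lambda>j. \<Sum>\<^sub>\<infinity>n\<in>I. d n * m n j) summable_on J"
    using summable_on_Sigma_banach[OF swapped] by simp
  have "(\<Sum>\<^sub>\<infinity>j\<in>J. \<Sum>\<^sub>\<infinity>n\<in>I. d n * m n j) = (\<Sum>\<^sub>\<infinity>n\<in>I. \<Sum>\<^sub>\<infinity>j\<in>J. d n * m n j)"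
    by (rule infsum_swap_banach[symmetric, OF prod])
  also have "\<dots> = (\<Sum>\<^sub>\<infinity>n\<in>I. d n * w n)"
    by (intro infsum_cong) (simp add: infsum_cmult_right' infsumI[OF m])
  finally show "(\<Sum>\<^sub>\<infinity>j\<in>J. \<Sum>\<^sub>\<infinity>n\<in>I. d n * m n j) = (\<Sum>\<^sub>\<infinity>n\<in>I. d n * w n)" .
qed

text \<open>Letting z tend to 0 kills the constant coefficient, and division by z shifts the
  remaining ones. The hypothesis leaves out z = 0 so that the shifted series, controlled only for
  nonzero z, satisfies it again.\<close>

lemma powser_zero_imp_coeff_zero:
  fixes a :: "nat \<Rightarrow> real"
  assumes "r > 0" and "\<And>z. z \<noteq> 0 \<Longrightarrow> \<bar>z\<bar> < r \<Longrightarrow> (\<lambda>n. a n * z ^ n) sums 0"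
  shows "a n = 0"
  using assms(2)
proof (induction n arbitrary: a)
  case (0 a)
  have "((\<lambda>_::real. 0) \<longlongrightarrow> a 0) (at 0)"
    using powser_limit_0_strong[OF \<open>r > 0\<close>, of a "\<lambda>_. 0"] 0 by simp
  then show ?case
    by (rule LIM_unique[OF _ tendsto_const])
next
  case (Suc n a)
  have "((\<lambda>_::real. 0) \<longlongrightarrow> a 0) (at 0)"
    using powser_limit_0_strong[OF \<open>r > 0\<close>, of a "\<lambda>_. 0"] Suc.prems by simp
  then have a0: "a 0 = 0"
    by (rule LIM_unique[OF _ tendsto_const])
  have "(\<lambda>n. a (Suc n) * z ^ n) sums 0" if "z \<noteq> 0" "\<bar>z\<bar> < r" for z
  proof -
    have "(\<lambda>n. a (Suc n) * z ^ Suc n) sums 0"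
      using sums_Suc_iff[of "\<lambda>n. a n * z ^ n" 0] Suc.prems[OF that] a0 by simp
    then have "(\<lambda>n. inverse z * (a (Suc n) * z ^ Suc n)) sums (inverse z * 0)"
      by (rule sums_mult)
    then show ?thesis
      using that by (simp add: field_simps)
  qed
  then show ?case
    by (rule Suc.IH)
qed

section \<open>Poisson weights as functions of the mean\<close>

definition poisson_weight :: "real \<Rightarrow> nat \<Rightarrow> real" where
  "poisson_weight x n = x ^ n / fact n * exp (- x)"

lemma poisson_weight_nonneg: "x \<ge> 0 \<Longrightarrow> poisson_weight x n \<ge> 0"
  by (simp add: poisson_weight_def)

text \<open>The exponent is kept in the form -(1 - z) * x because averaging over a random x then
  produces a Laplace transform in the variable 1 - z.\<close>

lemma poisson_weight_generating_function:
  "(\<lambda>n. poisson_weight x n * z ^ n) sums exp (- (1 - z) * x)"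
proof -
  have "(\<lambda>n. exp (- x) * ((z * x) ^ n /\<^sub>R fact n)) sums (exp (- x) * exp (z * x))"
    by (intro sums_mult exp_converges)
  then show ?thesis
    by (simp add: poisson_weight_def field_simps flip: exp_add)
qed

lemma poisson_weight_sums: "poisson_weight x sums 1"
  using poisson_weight_generating_function[of x 1] by simp

lemma poisson_weight_le_1: "x \<ge> 0 \<Longrightarrow> poisson_weight x n \<le> 1"
  using sum_le_suminf[of "poisson_weight x" "{n}"] poisson_weight_sums[of x]
  by (simp add: poisson_weight_nonneg sums_iff)

lemma summable_poisson_weight_mult:
  assumes "\<And>n. \<bar>w n\<bar> \<le> B"
  shows "summable (\<lambda>n. poisson_weight x n * w n)"
proof (rule summable_comparison_test')
  show "summable (\<lambda>n. exp (- x) * (B * (\<bar>x\<bar> ^ n /\<^sub>R fact n)))"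
    by (intro summable_mult summable_exp_generic)
  show "norm (poisson_weight x n * w n) \<le> exp (- x) * (B * (\<bar>x\<bar> ^ n /\<^sub>R fact n))" for n
    using mult_left_mono[OF assms[of n], of "\<bar>x\<bar> ^ n * exp (- x) / fact n"]
    by (simp add: poisson_weight_def abs_mult power_abs field_simps)
qed

text \<open>The mean is exp(-x) times an everywhere convergent power series with coefficients w n /
  n!. Differentiating the series shifts \<open>w\<close> by one, differentiating exp(-x) subtracts
  the original mean; together the generator of the unit rate Poisson process acts on
  \<open>w\<close>.\<close>

lemma has_real_derivative_poisson_mean:
  assumes w: "\<And>n. \<bar>w n\<bar> \<le> B"
  shows "((\<lambda>x. \<Sum>n. poisson_weight x n * w n) has_real_derivative
           (\<Sum>n. poisson_weight x n * (w (Suc n) - w n))) (at x)"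
proof -
  define c where "c = (\<lambda>n. w n / fact n)"
  have eq: "poisson_weight y n * v = exp (- y) * (v / fact n * y ^ n)" for y v n
    by (simp add: poisson_weight_def)
  have sm: "summable (\<lambda>n. v n / fact n * y ^ n)" if "\<And>n. \<bar>v n\<bar> \<le> B" for y and v :: "nat \<Rightarrow> real"
    using summable_mult[OF summable_poisson_weight_mult[of v B y, OF that], of "exp y"]
    by (simp add: eq flip: mult.assoc exp_add)
  have diffs_c: "diffs c n = w (Suc n) / fact n" for n
    by (simp add: diffs_def c_def)
  have D: "((\<lambda>x. \<Sum>n. c n * x ^ n) has_real_derivative (\<Sum>n. diffs c n * x ^ n)) (at x)"
    by (rule termdiffs_strong_converges_everywhere) (use sm w in \<open>auto simp: c_def\<close>)
  have "((\<lambda>x. exp (- x) * (\<Sum>n. c n * x ^ n)) has_real_derivative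
          exp (- x) * ((\<Sum>n. diffs c n * x ^ n) - (\<Sum>n. c n * x ^ n))) (at x)"
    by (rule derivative_eq_intros D refl | simp add: algebra_simps)+
  also have "(\<Sum>n. diffs c n * x ^ n) - (\<Sum>n. c n * x ^ n) = (\<Sum>n. (diffs c n - c n) * x ^ n)"
    unfolding diffs_c unfolding c_def
    by (subst suminf_diff) (use sm[of "\<lambda>n. w (Suc n)" x] sm[of w x] w in \<open>simp_all add: algebra_simps\<close>)
  also have "(\<lambda>n. (diffs c n - c n) * x ^ n) = (\<lambda>n. (w (Suc n) - w n) / fact n * x ^ n)"
    unfolding diffs_c unfolding c_def by (simp add: diff_divide_distrib)
  also have "exp (- x) * (\<Sum>n. (w (Suc n) - w n) / fact n * x ^ n) =
      (\<Sum>n. poisson_weight x n * (w (Suc n) - w n))"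
  proof -
    have "summable (\<lambda>n. (w (Suc n) - w n) / fact n * x ^ n)"
      using summable_diff[OF sm[of "\<lambda>n. w (Suc n)" x] sm[of w x]] w
      by (simp add: diff_divide_distrib left_diff_distrib)
    then show ?thesis
      unfolding eq by (rule suminf_mult[symmetric])
  qed
  also have "(\<lambda>x. exp (- x) * (\<Sum>n. c n * x ^ n)) = (\<lambda>x. \<Sum>n. poisson_weight x n * w n)"
    unfolding eq c_def by (rule ext) (intro suminf_mult[symmetric] sm w)
  finally show ?thesis .
qed

section \<open>Negative binomial weights\<close>

text \<open>The Pochhammer form also covers a = 0, where Gamma(a) has a pole and, for q < 1, the law
  is the point mass at 0. This case occurs when no jump of \<open>N\<close> has happened.\<close>

definition neg_binomial_weight :: "real \<Rightarrow> real \<Rightarrow> nat \<Rightarrow> real" where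
  "neg_binomial_weight a q j = pochhammer a j / fact j * q ^ j * (1 - q) powr a"

lemma neg_binomial_weight_nonneg: "0 \<le> a \<Longrightarrow> 0 \<le> q \<Longrightarrow> 0 \<le> neg_binomial_weight a q j"
  by (auto simp: neg_binomial_weight_def pochhammer_prod intro!: divide_nonneg_nonneg mult_nonneg_nonneg prod_nonneg)

text \<open>This is the binomial series for the exponent -a; the sign (-1)^j relating the
  generalized binomial coefficient to the Pochhammer symbol cancels against the sign of -(q *
  z).\<close>

lemma neg_binomial_weight_generating_function:
  assumes "\<bar>q * z\<bar> < 1"
  shows "(\<lambda>j. neg_binomial_weight a q j * z ^ j) sums ((1 - q) powr a * (1 - q * z) powr (- a))"
proof -
  have "(\<lambda>j. (- a gchoose j) * (- (q * z)) ^ j) sums (1 + - (q * z)) powr (- a)"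
    using assms by (intro gen_binomial_real) simp
  then have "(\<lambda>j. (1 - q) powr a * ((- a gchoose j) * (- (q * z)) ^ j)) sums
      ((1 - q) powr a * (1 + - (q * z)) powr (- a))"
    by (rule sums_mult)
  moreover have "(1 - q) powr a * ((- a gchoose j) * (- (q * z)) ^ j) = neg_binomial_weight a q j * z ^ j" for j
  proof -
    have "(- 1) ^ j * (- (q * z)) ^ j = (q * z) ^ j"
      by (simp flip: power_mult_distrib)
    then show ?thesis
      unfolding neg_binomial_weight_def gbinomial_pochhammer
      by (simp add: power_mult_distrib mult_ac)
  qed
  ultimately show ?thesis by simp
qed

lemma neg_binomial_weight_sums:
  assumes "0 \<le> q" "q < 1"
  shows "neg_binomial_weight a q sums 1"
  using neg_binomial_weight_generating_function[of q 1 a] assms by (simp add: powr_minus)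

subsection \<open>Random indices and independent time changes\<close>

context prob_space
begin

text \<open>A Poisson law whose mean is \<open>r\<close> times a Gamma variable is negative
  binomial. Both sides are coefficients of power series with the same sum on |z| < 1, where the
  Laplace transform is evaluated at (1 - z) * r \<ge> 0.\<close>

lemma expectation_poisson_weight_gamma:
  assumes [measurable]: "random_variable borel X"
    and X0: "\<And>\<omega>. \<omega> \<in> space M \<Longrightarrow> 0 \<le> X \<omega>"
    and laplace: "\<And>u. 0 \<le> u \<Longrightarrow> expectation (\<lambda>\<omega>. exp (- u * X \<omega>)) = (1 + u / \<beta>) powr (- a)"
    and pos: "\<beta> > 0" "r > 0"
  shows "expectation (\<lambda>\<omega>. poisson_weight (r * X \<omega>) j) = neg_binomial_weight a (r / (r + \<beta>)) j"
proof -
  \<comment> \<open>This \<open>q\<close> makes 1 + (1 - z) * r / \<beta> equal to (1 - q * z) / (1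
    - q), whose power -a is the negative binomial generating function.\<close>
  define q where "q = r / (r + \<beta>)"
  define e where "e = (\<lambda>j. expectation (\<lambda>\<omega>. poisson_weight (r * X \<omega>) j))"
  have q: "0 < q" "q < 1"
    using pos by (auto simp: q_def)
  have [measurable]: "(\<lambda>\<omega>. poisson_weight (r * X \<omega>) j) \<in> borel_measurable M" for j
    by (simp add: poisson_weight_def)
  have bounded: "norm (poisson_weight (r * X \<omega>) j) \<le> 1" if "\<omega> \<in> space M" for \<omega> j
    using X0[OF that] pos by (simp add: poisson_weight_nonneg poisson_weight_le_1)
  have int: "integrable M (\<lambda>\<omega>. poisson_weight (r * X \<omega>) j)" for j
    using bounded by (intro integrable_const_bound[where B = 1]) auto
  have gf: "(\<lambda>j. e j * z ^ j) sums ((1 - q) powr a * (1 - q * z) powr (- a))" if z: "\<bar>z\<bar> < 1" for z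
  proof -
    have qz: "q * z < 1"
      using q z mult_strict_mono[of q 1 "\<bar>z\<bar>" 1] by (smt (verit) mult_left_mono)
    have "(\<lambda>j. expectation (\<lambda>\<omega>. poisson_weight (r * X \<omega>) j * z ^ j)) sums
        expectation (\<lambda>\<omega>. \<Sum>j. poisson_weight (r * X \<omega>) j * z ^ j)"
    proof (rule sums_integral)
      show "AE \<omega> in M. summable (\<lambda>j. norm (poisson_weight (r * X \<omega>) j * z ^ j))"
      proof (rule AE_I2)
        fix \<omega> assume "\<omega> \<in> space M"
        then have "norm (poisson_weight (r * X \<omega>) j * z ^ j) = poisson_weight (r * X \<omega>) j * \<bar>z\<bar> ^ j" for j
          using X0 pos by (simp add: abs_mult power_abs poisson_weight_nonneg)
        then show "summable (\<lambda>j. norm (poisson_weight (r * X \<omega>) j * z ^ j))"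
          using poisson_weight_generating_function by (auto simp: sums_iff)
      qed
      \<comment> \<open>Poisson weights are at most 1, so a geometric series dominates; this is
        where |z| < 1 is needed for exchanging sum and expectation.\<close>
      show "summable (\<lambda>j. expectation (\<lambda>\<omega>. norm (poisson_weight (r * X \<omega>) j * z ^ j)))"
      proof (rule summable_comparison_test')
        show "summable (\<lambda>j. \<bar>z\<bar> ^ j)"
          using z by (simp add: summable_geometric)
        show "norm (expectation (\<lambda>\<omega>. norm (poisson_weight (r * X \<omega>) j * z ^ j))) \<le> \<bar>z\<bar> ^ j" for j
        proof -
          have "expectation (\<lambda>\<omega>. norm (poisson_weight (r * X \<omega>) j * z ^ j)) \<le> expectation (\<lambda>_. \<bar>z\<bar> ^ j)"
            using bounded by (intro integral_mono integrable_norm integrable_mult_left int)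
              (auto simp: abs_mult power_abs intro!: mult_left_le_one_le)
          then show ?thesis
            by (simp add: prob_space)
        qed
      qed
    qed (use int in auto)
    also have "(\<lambda>j. expectation (\<lambda>\<omega>. poisson_weight (r * X \<omega>) j * z ^ j)) = (\<lambda>j. e j * z ^ j)"
      by (simp add: e_def)
    also have "expectation (\<lambda>\<omega>. \<Sum>j. poisson_weight (r * X \<omega>) j * z ^ j) =
        expectation (\<lambda>\<omega>. exp (- ((1 - z) * r) * X \<omega>))"
      using poisson_weight_generating_function[THEN sums_unique, symmetric] by (simp add: algebra_simps)
    also have "\<dots> = (1 + (1 - z) * r / \<beta>) powr (- a)"
      using z pos by (intro laplace) auto
    also have "1 + (1 - z) * r / \<beta> = (1 - q * z) / (1 - q)"
    proof -
      have "1 - q = \<beta> / (r + \<beta>)" "1 - q * z = (r + \<beta> - r * z) / (r + \<beta>)"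
        using pos by (simp_all add: q_def field_simps)
      then have "(1 - q * z) / (1 - q) = (r + \<beta> - r * z) / \<beta>"
        using pos by simp
      then show ?thesis
        using pos by (simp add: field_simps)
    qed
    also have "\<dots> powr (- a) = (1 - q) powr a * (1 - q * z) powr (- a)"
      using qz q by (simp add: powr_divide powr_minus field_simps)
    finally show ?thesis .
  qed
  have "e j - neg_binomial_weight a q j = 0"
  proof (rule powser_zero_imp_coeff_zero[where r = 1])
    fix z :: real assume z: "\<bar>z\<bar> < 1"
    then have "\<bar>q * z\<bar> < 1"
      using q mult_strict_mono[of q 1 "\<bar>z\<bar>" 1] by (simp add: abs_mult)
    from sums_diff[OF gf[OF z] neg_binomial_weight_generating_function[OF this, of a]]
    show "(\<lambda>j. (e j - neg_binomial_weight a q j) * z ^ j) sums 0"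
      by (simp add: left_diff_distrib)
  qed simp
  then show ?thesis
    by (simp add: e_def q_def)
qed

lemma
  assumes [measurable]: "random_variable (count_space UNIV) N"
  shows integrable_indicator_preimage: "integrable M (\<lambda>\<omega>. indicator A (N \<omega>) :: real)"
    and expectation_indicator_preimage:
      "expectation (\<lambda>\<omega>. indicator A (N \<omega>)) = prob {\<omega> \<in> space M. N \<omega> \<in> A}"
proof -
  define S where "S = {\<omega> \<in> space M. N \<omega> \<in> A}"
  have "S = N -` A \<inter> space M"
    by (auto simp: S_def)
  then have S: "S \<in> events"
    by simp
  have eq: "indicator A (N \<omega>) = (indicator S \<omega> :: real)" if "\<omega> \<in> space M" for \<omega>
    using that by (auto simp: S_def indicator_def)
  have "integrable M (indicator S :: 'a \<Rightarrow> real)"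
    using S by (intro integrable_real_indicator) (auto simp: less_top[symmetric])
  then show "integrable M (\<lambda>\<omega>. indicator A (N \<omega>) :: real)"
    by (subst Bochner_Integration.integrable_cong[OF refl eq])
  have "expectation (\<lambda>\<omega>. indicator A (N \<omega>)) = (expectation (indicator S) :: real)"
    by (intro Bochner_Integration.integral_cong refl eq)
  then show "expectation (\<lambda>\<omega>. indicator A (N \<omega>)) = prob {\<omega> \<in> space M. N \<omega> \<in> A}"
    using S by (simp add: S_def)
qed

text \<open>Splits the expectation over the events that \<open>K\<close> equals n, without any
  independence. The terms are dominated by \<open>B\<close> times the probabilities of these events,
  which sum to 1.\<close>

lemma expectation_random_index_sums:
  fixes K :: "'a \<Rightarrow> nat" and V :: "nat \<Rightarrow> 'a \<Rightarrow> real"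
  assumes [measurable]: "random_variable (count_space UNIV) K" "\<And>n. random_variable borel (V n)"
    and B: "\<And>n \<omega>. \<omega> \<in> space M \<Longrightarrow> \<bar>V n \<omega>\<bar> \<le> B"
  shows "(\<lambda>n. expectation (\<lambda>\<omega>. V n \<omega> * indicator {n} (K \<omega>))) sums expectation (\<lambda>\<omega>. V (K \<omega>) \<omega>)"
proof -
  have B0: "0 \<le> B"
    using B not_empty by (meson abs_ge_zero ex_in_conv order_trans)
  have K: "(\<lambda>n. prob {\<omega> \<in> space M. K \<omega> = n}) sums 1"
  proof -
    have "(\<lambda>n. prob {\<omega> \<in> space M. K \<omega> = n}) sums prob (\<Union>n. {\<omega> \<in> space M. K \<omega> = n})"
      by (intro finite_measure_UNION) (auto simp: disjoint_family_on_def)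
    also have "(\<Union>n. {\<omega> \<in> space M. K \<omega> = n}) = space M"
      by auto
    finally show ?thesis
      by (simp add: prob_space)
  qed
  have int: "integrable M (\<lambda>\<omega>. V n \<omega> * indicator {n} (K \<omega>))" for n
    using B B0 by (intro integrable_const_bound[where B = B]) (auto simp: indicator_def)
  have "(\<lambda>n. expectation (\<lambda>\<omega>. V n \<omega> * indicator {n} (K \<omega>))) sums
      expectation (\<lambda>\<omega>. \<Sum>n. V n \<omega> * indicator {n} (K \<omega>))"
  proof (rule sums_integral[OF int])
    show "AE \<omega> in M. summable (\<lambda>n. norm (V n \<omega> * indicator {n} (K \<omega>)))"
      by (rule AE_I2, rule summable_finite[of "{K \<omega>}" for \<omega>]) (auto simp: indicator_def)
    show "summable (\<lambda>n. expectation (\<lambda>\<omega>. norm (V n \<omega> * indicator {n} (K \<omega>))))"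
    proof (rule summable_comparison_test')
      show "summable (\<lambda>n. B * prob {\<omega> \<in> space M. K \<omega> = n})"
        using K by (intro summable_mult) (simp add: sums_iff)
      show "norm (expectation (\<lambda>\<omega>. norm (V n \<omega> * indicator {n} (K \<omega>)))) \<le>
          B * prob {\<omega> \<in> space M. K \<omega> = n}" for n
      proof -
        have "expectation (\<lambda>\<omega>. norm (V n \<omega> * indicator {n} (K \<omega>))) \<le> expectation (\<lambda>\<omega>. B * indicator {n} (K \<omega>))"
          using B by (intro integral_mono integrable_norm int integrable_mult_right integrable_indicator_preimage)
            (auto simp: indicator_def)
        also have "\<dots> = B * prob {\<omega> \<in> space M. K \<omega> = n}"
          by (simp add: expectation_indicator_preimage)
        finally show ?thesis
          by simp
      qed
    qed
  qed
  also have "(\<lambda>\<omega>. \<Sum>n. V n \<omega> * indicator {n} (K \<omega>)) = (\<lambda>\<omega>. V (K \<omega>) \<omega>)"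
  proof
    show "(\<Sum>n. V n \<omega> * indicator {n} (K \<omega>)) = V (K \<omega>) \<omega>" for \<omega>
      by (subst suminf_finite[of "{K \<omega>}"]) auto
  qed
  finally show ?thesis .
qed

lemma random_variable_nat_of_real:
  "random_variable borel (\<lambda>\<omega>. real (N \<omega>)) \<Longrightarrow> random_variable (count_space UNIV) N"
  using measurable_compose[of "\<lambda>\<omega>. real (N \<omega>)" M borel "\<lambda>x. nat \<lfloor>x\<rfloor>" "count_space UNIV"] by simp

text \<open>Each term factors because Z n is independent of the indicator of K = n. It serves both
  for \<open>G\<close> at the random count N(s) and for \<open>N\<^sub>1\<close> at a discretized
  random time.\<close>

lemma expectation_indep_random_index_sums:
  fixes K :: "'a \<Rightarrow> nat" and Z :: "nat \<Rightarrow> 'a \<Rightarrow> real" and h :: "real \<Rightarrow> real"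
  assumes indep: "\<And>n. indep_var borel (Z n) borel (\<lambda>\<omega>. real (K \<omega>))"
    and [measurable]: "h \<in> borel_measurable borel"
    and B: "\<And>n \<omega>. \<omega> \<in> space M \<Longrightarrow> \<bar>h (Z n \<omega>)\<bar> \<le> B"
  shows "(\<lambda>n. prob {\<omega> \<in> space M. K \<omega> = n} * expectation (\<lambda>\<omega>. h (Z n \<omega>))) sums
    expectation (\<lambda>\<omega>. h (Z (K \<omega>) \<omega>))"
proof -
  have [measurable]: "random_variable borel (Z n)" "random_variable (count_space UNIV) K" for n
    using indep_var_rv1[OF indep] random_variable_nat_of_real[OF indep_var_rv2[OF indep]] by auto
  have int: "integrable M (\<lambda>\<omega>. h (Z n \<omega>))" for n
    using B by (intro integrable_const_bound[where B = B]) auto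
  have "expectation (\<lambda>\<omega>. h (Z n \<omega>) * indicator {n} (K \<omega>)) =
      prob {\<omega> \<in> space M. K \<omega> = n} * expectation (\<lambda>\<omega>. h (Z n \<omega>))" for n
  proof -
    have "indep_var borel (h \<circ> Z n) borel (indicator {real n} \<circ> (\<lambda>\<omega>. real (K \<omega>)) :: 'a \<Rightarrow> real)"
      by (rule indep_var_compose[OF indep]) auto
    then have ind: "indep_var borel (\<lambda>\<omega>. h (Z n \<omega>)) borel (\<lambda>\<omega>. indicator {n} (K \<omega>) :: real)"
      by (simp add: comp_def indicator_def)
    show ?thesis
      by (subst indep_var_lebesgue_integral[OF ind int integrable_indicator_preimage])
        (simp_all add: expectation_indicator_preimage)
  qed
  then show ?thesis
    using expectation_random_index_sums[of K "\<lambda>n \<omega>. h (Z n \<omega>)" B] B by simp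
qed

text \<open>Independence is assumed between \<open>X\<close> and N at each fixed time. Rounding
  \<open>X\<close> up to a dyadic time leaves countably many times to consider, and along these
  times each path is eventually equal to its value at \<open>X\<close>. The rounding must go
  upwards, since the paths are controlled only to the right. Measurability passes to the pointwise
  limit, the expectations by bounded convergence.\<close>

lemma
  fixes N :: "real \<Rightarrow> 'a \<Rightarrow> nat" and X :: "'a \<Rightarrow> real" and \<Psi> :: "real \<Rightarrow> real"
  assumes [measurable]: "random_variable borel X"
    and X0: "\<And>\<omega>. \<omega> \<in> space M \<Longrightarrow> 0 \<le> X \<omega>"
    and right: "\<And>\<omega> t. \<omega> \<in> space M \<Longrightarrow> 0 \<le> t \<Longrightarrow> \<forall>\<^sub>F s in at_right t. N s \<omega> = N t \<omega>"
    and indep: "\<And>t. 0 \<le> t \<Longrightarrow> indep_var borel (\<lambda>\<omega>. real (N t \<omega>)) borel X"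
  shows measurable_right_continuous_time_change: "random_variable (count_space UNIV) (\<lambda>\<omega>. N (X \<omega>) \<omega>)"
    and prob_indep_time_change:
      "continuous_on UNIV \<Psi> \<Longrightarrow> (\<And>t. 0 \<le> t \<Longrightarrow> prob {\<omega> \<in> space M. N t \<omega> \<in> A} = \<Psi> t) \<Longrightarrow>
        prob {\<omega> \<in> space M. N (X \<omega>) \<omega> \<in> A} = expectation (\<lambda>\<omega>. \<Psi> (X \<omega>))"
proof -
  text \<open>\<^term>\<open>\<tau> m (K m \<omega>)\<close> is the smallest multiple of \<open>1 / 2^m\<close> strictly above \<^term>\<open>X \<omega>\<close>.\<close>
  define K where "K m \<omega> = nat \<lfloor>X \<omega> * 2 ^ m\<rfloor>" for m \<omega>
  define \<tau> :: "nat \<Rightarrow> nat \<Rightarrow> real" where "\<tau> m n = (real n + 1) / 2 ^ m" for m n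
  have [measurable]: "random_variable (count_space UNIV) (N t)" if "0 \<le> t" for t
    by (rule random_variable_nat_of_real[OF indep_var_rv1[OF indep[OF that]]])
  have \<tau>0: "0 \<le> \<tau> m n" for m n
    by (simp add: \<tau>_def)
  have K_measurable [measurable]: "random_variable (count_space UNIV) (K m)" for m
    unfolding K_def by measurable
  have N\<tau> [measurable]: "random_variable (count_space UNIV) (N (\<tau> m n))" for m n
    using \<tau>0 by measurable
  have bounds: "X \<omega> < \<tau> m (K m \<omega>)" "\<tau> m (K m \<omega>) \<le> X \<omega> + 1 / 2 ^ m" if "\<omega> \<in> space M" for m \<omega>
  proof -
    have "real (K m \<omega>) = of_int \<lfloor>X \<omega> * 2 ^ m\<rfloor>"
      using X0[OF that] by (simp add: K_def)
    then have "X \<omega> * 2 ^ m < real (K m \<omega>) + 1" "real (K m \<omega>) \<le> X \<omega> * 2 ^ m"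
      by linarith+
    then show "X \<omega> < \<tau> m (K m \<omega>)" "\<tau> m (K m \<omega>) \<le> X \<omega> + 1 / 2 ^ m"
      by (simp_all add: \<tau>_def field_simps)
  qed
  have lim: "(\<lambda>m. \<tau> m (K m \<omega>)) \<longlonglongrightarrow> X \<omega>" if "\<omega> \<in> space M" for \<omega>
  proof (rule tendsto_sandwich[where f = "\<lambda>_. X \<omega>" and h = "\<lambda>m. X \<omega> + 1 / 2 ^ m"])
    have "(\<lambda>m. X \<omega> + (1 / 2) ^ m) \<longlonglongrightarrow> X \<omega> + 0"
      by (intro tendsto_add tendsto_const LIMSEQ_power_zero) simp
    then show "(\<lambda>m. X \<omega> + 1 / 2 ^ m) \<longlonglongrightarrow> X \<omega>"
      by (simp add: power_divide)
  qed (use bounds[OF that] in \<open>auto intro!: always_eventually less_imp_le\<close>)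
  \<comment> \<open>Strictness of the lower bound matters: \<open>at_right\<close> excludes the
    point X \<omega> itself.\<close>
  have lim_right: "filterlim (\<lambda>m. \<tau> m (K m \<omega>)) (at_right (X \<omega>)) sequentially" if "\<omega> \<in> space M" for \<omega>
    unfolding filterlim_at
  proof
    show "\<forall>\<^sub>F m in sequentially. \<tau> m (K m \<omega>) \<in> {X \<omega><..} \<and> \<tau> m (K m \<omega>) \<noteq> X \<omega>"
    proof (intro always_eventually allI)
      show "\<tau> m (K m \<omega>) \<in> {X \<omega><..} \<and> \<tau> m (K m \<omega>) \<noteq> X \<omega>" for m
        using bounds(1)[OF that, of m] by auto
    qed
  qed (rule lim[OF that])
  have ev: "\<forall>\<^sub>F m in sequentially. N (\<tau> m (K m \<omega>)) \<omega> = N (X \<omega>) \<omega>" if "\<omega> \<in> space M" for \<omega>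
    using right[OF that X0[OF that]] lim_right[OF that] by (rule eventually_compose_filterlim)
  have N_K [measurable]: "random_variable (count_space UNIV) (\<lambda>\<omega>. N (\<tau> m (K m \<omega>)) \<omega>)" for m
    by (rule measurable_compose_countable[where f = "\<lambda>n. N (\<tau> m n)" and g = "K m"]) measurable
  have "random_variable borel (\<lambda>\<omega>. real (N (X \<omega>) \<omega>))"
  proof (rule borel_measurable_LIMSEQ_real)
    show "(\<lambda>m. real (N (\<tau> m (K m \<omega>)) \<omega>)) \<longlonglongrightarrow> real (N (X \<omega>) \<omega>)" if "\<omega> \<in> space M" for \<omega>
      using ev[OF that] by (intro tendsto_eventually) (auto elim: eventually_mono)
  qed measurable
  then show N_X [measurable]: "random_variable (count_space UNIV) (\<lambda>\<omega>. N (X \<omega>) \<omega>)"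
    by (rule random_variable_nat_of_real)
  assume cont: "continuous_on UNIV \<Psi>"
    and \<Psi>: "\<And>t. 0 \<le> t \<Longrightarrow> prob {\<omega> \<in> space M. N t \<omega> \<in> A} = \<Psi> t"
  have [measurable]: "\<Psi> \<in> borel_measurable borel"
    by (rule borel_measurable_continuous_onI) fact
  have \<Psi>_bound: "\<bar>\<Psi> t\<bar> \<le> 1" if "0 \<le> t" for t
    using \<Psi>[OF that, symmetric] by simp
  \<comment> \<open>Both expectations are expanded over the values n of \<open>K m\<close>. Where
    \<open>K m\<close> equals n, the time is the constant \<tau> m n, and the probability at that
    time is \<Psi> (\<tau> m n) by hypothesis.\<close>
  have disc: "expectation (\<lambda>\<omega>. indicator A (N (\<tau> m (K m \<omega>)) \<omega>)) = expectation (\<lambda>\<omega>. \<Psi> (\<tau> m (K m \<omega>)))" for m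
  proof -
    have ind: "indep_var borel (\<lambda>\<omega>. real (N (\<tau> m n) \<omega>)) borel (\<lambda>\<omega>. real (K m \<omega>))" for n
    proof -
      have "indep_var borel ((\<lambda>x. x) \<circ> (\<lambda>\<omega>. real (N (\<tau> m n) \<omega>))) borel ((\<lambda>x. real (nat \<lfloor>x * 2 ^ m\<rfloor>)) \<circ> X)"
        by (rule indep_var_compose[OF indep[OF \<tau>0]]) auto
      then show ?thesis
        by (simp add: comp_def K_def)
    qed
    have "(\<lambda>n. prob {\<omega> \<in> space M. K m \<omega> = n} * expectation (\<lambda>\<omega>. indicator A (N (\<tau> m n) \<omega>))) sums
        expectation (\<lambda>\<omega>. indicator A (N (\<tau> m (K m \<omega>)) \<omega>))"
      using expectation_indep_random_index_sums[where B = 1 and h = "\<lambda>x. indicator A (nat \<lfloor>x\<rfloor>)", OF ind]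
      by (simp add: indicator_def)
    moreover have "(\<lambda>n. expectation (\<lambda>\<omega>. \<Psi> (\<tau> m n) * indicator {n} (K m \<omega>))) sums
        expectation (\<lambda>\<omega>. \<Psi> (\<tau> m (K m \<omega>)))"
      by (rule expectation_random_index_sums[where B = 1]) (auto intro: \<Psi>_bound \<tau>0)
    moreover have "prob {\<omega> \<in> space M. K m \<omega> = n} * expectation (\<lambda>\<omega>. indicator A (N (\<tau> m n) \<omega>)) =
        expectation (\<lambda>\<omega>. \<Psi> (\<tau> m n) * indicator {n} (K m \<omega>))" for n
      by (simp add: expectation_indicator_preimage \<Psi> \<tau>0)
    ultimately show ?thesis
      by (simp add: sums_iff)
  qed
  have "(\<lambda>m. expectation (\<lambda>\<omega>. indicator A (N (\<tau> m (K m \<omega>)) \<omega>))) \<longlonglongrightarrow> expectation (\<lambda>\<omega>. indicator A (N (X \<omega>) \<omega>) :: real)"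
  proof (rule integral_dominated_convergence[where w = "\<lambda>_. 1"])
    show "AE \<omega> in M. (\<lambda>m. indicator A (N (\<tau> m (K m \<omega>)) \<omega>)) \<longlonglongrightarrow> (indicator A (N (X \<omega>) \<omega>) :: real)"
    proof (rule AE_I2)
      fix \<omega> assume "\<omega> \<in> space M"
      from ev[OF this] show "(\<lambda>m. indicator A (N (\<tau> m (K m \<omega>)) \<omega>)) \<longlonglongrightarrow> (indicator A (N (X \<omega>) \<omega>) :: real)"
        by (intro tendsto_eventually) (auto elim: eventually_mono)
    qed
  qed (auto simp: indicator_def)
  moreover have "(\<lambda>m. expectation (\<lambda>\<omega>. \<Psi> (\<tau> m (K m \<omega>)))) \<longlonglongrightarrow> expectation (\<lambda>\<omega>. \<Psi> (X \<omega>))"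
  proof (rule integral_dominated_convergence[where w = "\<lambda>_. 1"])
    show "AE \<omega> in M. (\<lambda>m. \<Psi> (\<tau> m (K m \<omega>))) \<longlonglongrightarrow> \<Psi> (X \<omega>)"
      using cont lim by (intro AE_I2) (auto intro!: continuous_on_tendsto_compose[of UNIV \<Psi>])
    show "AE \<omega> in M. norm (\<Psi> (\<tau> m (K m \<omega>))) \<le> 1" for m
      by (intro AE_I2) (simp add: \<Psi>_bound \<tau>0)
    show "random_variable borel (\<lambda>\<omega>. \<Psi> (\<tau> m (K m \<omega>)))" for m
      unfolding \<tau>_def by measurable
  qed auto
  ultimately have "expectation (\<lambda>\<omega>. indicator A (N (X \<omega>) \<omega>) :: real) = expectation (\<lambda>\<omega>. \<Psi> (X \<omega>))"
    unfolding disc by (rule LIMSEQ_unique)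
  then show "prob {\<omega> \<in> space M. N (X \<omega>) \<omega> \<in> A} = expectation (\<lambda>\<omega>. \<Psi> (X \<omega>))"
    by (simp add: expectation_indicator_preimage)
qed

end

subsection \<open>Processes and first passage times\<close>

context prob_space
begin

lemma
  assumes "subordinator X"
  shows subordinator_measurable: "0 \<le> t \<Longrightarrow> random_variable borel (X t)"
    and subordinator_zero: "\<omega> \<in> space M \<Longrightarrow> X 0 \<omega> = 0"
    and subordinator_mono: "\<omega> \<in> space M \<Longrightarrow> 0 \<le> s \<Longrightarrow> s \<le> t \<Longrightarrow> X s \<omega> \<le> X t \<omega>"
    and subordinator_nonneg: "\<omega> \<in> space M \<Longrightarrow> 0 \<le> t \<Longrightarrow> 0 \<le> X t \<omega>"
    and subordinator_right_continuous:
      "\<omega> \<in> space M \<Longrightarrow> 0 \<le> t \<Longrightarrow> continuous (at_right t) (\<lambda>s. X s \<omega>)"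
proof -
  show zero: "X 0 \<omega> = 0" if "\<omega> \<in> space M" for \<omega>
    using assms that by (simp add: subordinator_def levy_process_def)
  show mono: "X s \<omega> \<le> X t \<omega>" if "\<omega> \<in> space M" "0 \<le> s" "s \<le> t" for s t \<omega>
    using assms that by (auto simp: subordinator_def monotone_on_def)
  show "0 \<le> X t \<omega>" if "\<omega> \<in> space M" "0 \<le> t" for \<omega>
    using mono[of \<omega> 0 t] zero that by simp
qed (use assms in \<open>auto simp: subordinator_def levy_process_def\<close>)

lemma poisson_process_subordinator: "poisson_process r N \<Longrightarrow> subordinator (\<lambda>t \<omega>. real (N t \<omega>))"
  by (simp add: poisson_process_def)

lemma poisson_process_measurable:
  assumes "poisson_process r N" "0 \<le> t"
  shows "random_variable (count_space UNIV) (N t)"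
  by (rule random_variable_nat_of_real)
    (rule subordinator_measurable[OF poisson_process_subordinator[OF assms(1)] assms(2)])

lemma poisson_process_prob:
  "poisson_process r N \<Longrightarrow> 0 \<le> t \<Longrightarrow> prob {\<omega> \<in> space M. N t \<omega> = n} = poisson_weight (r * t) n"
  by (simp add: poisson_process_def poisson_weight_def)

text \<open>For values in the naturals, being within distance 1 of the limit means being equal to
  it.\<close>

lemma poisson_process_right_locally_constant:
  assumes "poisson_process r N" "\<omega> \<in> space M" "0 \<le> t"
  shows "\<forall>\<^sub>F s in at_right t. N s \<omega> = N t \<omega>"
proof -
  have "((\<lambda>s. real (N s \<omega>)) \<longlongrightarrow> real (N t \<omega>)) (at_right t)"
    using subordinator_right_continuous[OF poisson_process_subordinator[OF assms(1)] assms(2,3)]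
    by (simp add: continuous_within)
  then have "\<forall>\<^sub>F s in at_right t. dist (real (N s \<omega>)) (real (N t \<omega>)) < 1"
    by (rule tendstoD) simp
  then show ?thesis
    by (rule eventually_mono) (auto simp: dist_real_def)
qed

text \<open>The complement involves only the finitely many levels below k, so the tail is visibly a
  continuous function of t.\<close>

lemma poisson_process_tail_prob:
  assumes N: "poisson_process r N" and t: "0 \<le> t"
  shows "prob {\<omega> \<in> space M. k \<le> N t \<omega>} = 1 - (\<Sum>j<k. poisson_weight (r * t) j)"
proof -
  note [measurable] = poisson_process_measurable[OF N t]
  have "prob {\<omega> \<in> space M. k \<le> N t \<omega>} = prob (space M - (\<Union>j<k. {\<omega> \<in> space M. N t \<omega> = j}))"
    by (rule arg_cong[where f = prob]) auto
  also have "\<dots> = 1 - prob (\<Union>j<k. {\<omega> \<in> space M. N t \<omega> = j})"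
    by (intro prob_compl sets.finite_UN) auto
  also have "prob (\<Union>j<k. {\<omega> \<in> space M. N t \<omega> = j}) = (\<Sum>j<k. prob {\<omega> \<in> space M. N t \<omega> = j})"
    by (intro finite_measure_finite_Union) (auto simp: disjoint_family_on_def)
  finally show ?thesis
    by (simp add: poisson_process_prob[OF N t])
qed

lemma indep_processes_marginal:
  assumes "indep_processes X Y" "0 \<le> s" "0 \<le> t"
  shows "indep_var borel (X s) borel (Y t)"
proof -
  have "indep_var borel ((\<lambda>f. f s) \<circ> (\<lambda>\<omega>. \<lambda>t\<in>{0..}. X t \<omega>)) borel ((\<lambda>f. f t) \<circ> (\<lambda>\<omega>. \<lambda>t\<in>{0..}. Y t \<omega>))"
    using assms(1) unfolding indep_processes_def
    by (rule indep_var_compose) (use assms(2,3) in \<open>auto intro: measurable_component_singleton\<close>)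
  then show ?thesis
    using assms(2,3) by (simp add: comp_def)
qed

lemma indep_var_swap: "indep_var S X T Y \<Longrightarrow> indep_var T Y S X"
proof -
  have "indep_set A B \<Longrightarrow> indep_set B A" for A B
    unfolding indep_sets2_eq by (metis Int_commute mult.commute)
  then show "indep_var S X T Y \<Longrightarrow> indep_var T Y S X"
    unfolding indep_var_eq by blast
qed

end

lemma first_passage_time_le_iff:
  assumes "0 \<le> t"
    and mono: "\<And>s s'. 0 \<le> s \<Longrightarrow> s \<le> s' \<Longrightarrow> Y s \<omega> \<le> Y s' \<omega>"
    and right: "\<forall>\<^sub>F s in at_right t. Y s \<omega> = Y t \<omega>"
  shows "first_passage_time Y k \<omega> \<le> ereal t \<longleftrightarrow> k \<le> Y t \<omega>"
proof
  assume "k \<le> Y t \<omega>"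
  then show "first_passage_time Y k \<omega> \<le> ereal t"
    using \<open>0 \<le> t\<close> unfolding first_passage_time_def by (intro INF_lower) simp
next
  \<comment> \<open>The infimum need not be known to be attained: the level is reached at some time
    before \<open>u\<close>, and between t and \<open>u\<close> the path still has its value at
    t.\<close>
  assume le: "first_passage_time Y k \<omega> \<le> ereal t"
  obtain u where u: "t < u" "\<And>s. t < s \<Longrightarrow> s < u \<Longrightarrow> Y s \<omega> = Y t \<omega>"
    using right unfolding eventually_at_right_field by blast
  have "first_passage_time Y k \<omega> < ereal u"
    using le u(1) by (auto intro: le_less_trans)
  then obtain s where s: "0 \<le> s" "k \<le> Y s \<omega>" "s < u"
    unfolding first_passage_time_def INF_less_iff by auto
  show "k \<le> Y t \<omega>"
    using u(2)[of s] mono[of s t] s by (cases "s \<le> t") auto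
qed

lemma first_passage_time_nonneg: "0 \<le> first_passage_time Y k \<omega>"
  unfolding first_passage_time_def by (intro INF_greatest) simp

subsection \<open>The distribution of the first passage time\<close>

locale poisson_gamma_passage = prob_space M for M :: "'a measure" +
  fixes N N\<^sub>1 :: "real \<Rightarrow> 'a \<Rightarrow> nat" and G :: "real \<Rightarrow> 'a \<Rightarrow> real"
    and lam\<^sub>1 lam \<alpha> \<beta> :: real and k :: nat
  assumes pos: "lam\<^sub>1 > 0" "lam > 0" "\<alpha> > 0" "\<beta> > 0" "k \<ge> 1"
    and N\<^sub>1: "poisson_process lam\<^sub>1 N\<^sub>1"
    and N: "poisson_process lam N"
    and G: "gamma_process \<alpha> \<beta> G"
    and indep_G_N: "indep_processes G (\<lambda>t \<omega>. real (N t \<omega>))"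
    and indep_GN_N1: "indep_processes (time_change G (\<lambda>t \<omega>. real (N t \<omega>))) (\<lambda>t \<omega>. real (N\<^sub>1 t \<omega>))"
begin

definition G\<^sub>N where "G\<^sub>N = time_change G (\<lambda>t \<omega>. real (N t \<omega>))"

definition T where "T = first_passage_time (time_change N\<^sub>1 G\<^sub>N) k"

text \<open>For x \<ge> 0 the probability that \<open>N\<^sub>1 x\<close> is at least k. The finite
  sum extends it continuously to all reals, as \<open>prob_indep_time_change\<close>
  requires.\<close>

definition \<Psi> where "\<Psi> x = 1 - (\<Sum>j<k. poisson_weight (lam\<^sub>1 * x) j)"

text \<open>The weight w(n) of the overview, written as a complement;
  \<open>neg_binomial_tail_has_sum\<close> converts it into a sum over the levels j \<ge> k.\<close>

definition tail where
  "tail n = 1 - (\<Sum>j<k. neg_binomial_weight (\<alpha> * real n) (lam\<^sub>1 / (lam\<^sub>1 + \<beta>)) j)"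

definition cdf_T where "cdf_T s = (\<Sum>n. poisson_weight (lam * s) n * tail n)"

definition pdf_T where "pdf_T s = lam * (\<Sum>n. poisson_weight (lam * s) n * (tail (Suc n) - tail n))"

lemma G_subordinator: "subordinator G"
  using G by (simp add: gamma_process_def)

lemmas N_subordinator = poisson_process_subordinator[OF N]
lemmas N1_subordinator = poisson_process_subordinator[OF N\<^sub>1]

lemma G_laplace:
  assumes "0 \<le> t" "0 \<le> u"
  shows "expectation (\<lambda>\<omega>. exp (- u * G t \<omega>)) = (1 + u / \<beta>) powr (- (\<alpha> * t))"
proof -
  have "expectation (\<lambda>\<omega>. exp (- u * G t \<omega>)) = (1 + u / \<beta>) powr (- \<alpha> * t)"
    using G assms unfolding gamma_process_def by blast
  then show ?thesis
    by simp
qed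

lemma GN_eq: "G\<^sub>N s \<omega> = G (real (N s \<omega>)) \<omega>"
  by (simp add: G\<^sub>N_def time_change_def)

lemma GN_nonneg: "\<omega> \<in> space M \<Longrightarrow> 0 \<le> G\<^sub>N s \<omega>"
  by (simp add: GN_eq subordinator_nonneg[OF G_subordinator])

lemma GN_measurable:
  assumes "0 \<le> s"
  shows "random_variable borel (G\<^sub>N s)"
proof -
  have "random_variable borel (\<lambda>\<omega>. G (real (N s \<omega>)) \<omega>)"
    by (rule measurable_compose_countable[where f = "\<lambda>n. G (real n)" and g = "N s"])
      (use assms poisson_process_measurable[OF N] subordinator_measurable[OF G_subordinator] in auto)
  then show ?thesis
    by (simp add: GN_eq[abs_def])
qed

text \<open>The bound on \<open>h\<close> is asked only for x \<ge> 0 because the two instances,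
  \<Psi> and a decaying exponential, are unbounded on the negative axis.\<close>

lemma expectation_GN_sums:
  assumes s: "0 \<le> s" and h: "h \<in> borel_measurable borel" and B: "\<And>x. 0 \<le> x \<Longrightarrow> \<bar>h x\<bar> \<le> B"
  shows "(\<lambda>n. poisson_weight (lam * s) n * expectation (\<lambda>\<omega>. h (G (real n) \<omega>))) sums
    expectation (\<lambda>\<omega>. h (G\<^sub>N s \<omega>))"
proof -
  have "(\<lambda>n. prob {\<omega> \<in> space M. N s \<omega> = n} * expectation (\<lambda>\<omega>. h (G (real n) \<omega>))) sums
      expectation (\<lambda>\<omega>. h (G (real (N s \<omega>)) \<omega>))"
  proof (rule expectation_indep_random_index_sums[where B = B and Z = "\<lambda>n. G (real n)" and h = h])
    show "indep_var borel (G (real n)) borel (\<lambda>\<omega>. real (N s \<omega>))" for n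
      using indep_processes_marginal[OF indep_G_N _ s] by simp
    show "\<bar>h (G (real n) \<omega>)\<bar> \<le> B" if "\<omega> \<in> space M" for n \<omega>
      by (intro B subordinator_nonneg[OF G_subordinator that]) simp
  qed (rule h)
  then show ?thesis
    by (simp add: GN_eq poisson_process_prob[OF N s])
qed

section \<open>The probability of reaching level k within the random time G(n)\<close>

lemma continuous_on_Psi: "continuous_on UNIV \<Psi>"
  unfolding \<Psi>_def poisson_weight_def by (intro continuous_intros) auto

lemma borel_measurable_Psi [measurable]: "\<Psi> \<in> borel_measurable borel"
  by (rule borel_measurable_continuous_onI[OF continuous_on_Psi])

lemma Psi_eq_prob: "0 \<le> t \<Longrightarrow> \<Psi> t = prob {\<omega> \<in> space M. k \<le> N\<^sub>1 t \<omega>}"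
  by (simp add: \<Psi>_def poisson_process_tail_prob[OF N\<^sub>1])

lemma Psi_bounds: "0 \<le> t \<Longrightarrow> 0 \<le> \<Psi> t" "0 \<le> t \<Longrightarrow> \<Psi> t \<le> 1"
  by (simp_all add: Psi_eq_prob)

text \<open>Follows from the monotone paths of \<open>N\<^sub>1\<close> through inclusion of events,
  which avoids differentiating the finite sum.\<close>

lemma Psi_mono:
  assumes "0 \<le> s" "s \<le> t"
  shows "\<Psi> s \<le> \<Psi> t"
proof -
  have [measurable]: "random_variable (count_space UNIV) (N\<^sub>1 t)"
    using assms by (intro poisson_process_measurable[OF N\<^sub>1]) simp
  have "prob {\<omega> \<in> space M. k \<le> N\<^sub>1 s \<omega>} \<le> prob {\<omega> \<in> space M. k \<le> N\<^sub>1 t \<omega>}"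
    using subordinator_mono[OF N1_subordinator _ assms] by (intro finite_measure_mono) force+
  then show ?thesis
    using assms by (simp add: Psi_eq_prob)
qed

lemma expectation_Psi_G: "expectation (\<lambda>\<omega>. \<Psi> (G (real n) \<omega>)) = tail n"
proof -
  note [measurable] = subordinator_measurable[OF G_subordinator, of "real n"]
  have nonneg: "0 \<le> lam\<^sub>1 * G (real n) \<omega>" if "\<omega> \<in> space M" for \<omega>
    using pos subordinator_nonneg[OF G_subordinator that] by simp
  have "integrable M (\<lambda>\<omega>. poisson_weight (lam\<^sub>1 * G (real n) \<omega>) j)" for j
    using nonneg
    by (intro integrable_const_bound[where B = 1])
      (auto simp: poisson_weight_nonneg poisson_weight_le_1, simp add: poisson_weight_def)
  then have "expectation (\<lambda>\<omega>. \<Psi> (G (real n) \<omega>)) =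
      1 - (\<Sum>j<k. expectation (\<lambda>\<omega>. poisson_weight (lam\<^sub>1 * G (real n) \<omega>) j))"
    by (simp add: \<Psi>_def prob_space)
  also have "\<dots> = tail n"
    unfolding tail_def
    by (intro arg_cong2[where f = minus] sum.cong refl expectation_poisson_weight_gamma)
      (use pos G_laplace in \<open>auto intro: subordinator_nonneg[OF G_subordinator]\<close>)
  finally show ?thesis .
qed

lemma integrable_Psi_G: "integrable M (\<lambda>\<omega>. \<Psi> (G (real n) \<omega>))"
proof (rule integrable_const_bound[where B = 1])
  note [measurable] = subordinator_measurable[OF G_subordinator, of "real n"]
  show "random_variable borel (\<lambda>\<omega>. \<Psi> (G (real n) \<omega>))"
    by measurable
qed (use Psi_bounds subordinator_nonneg[OF G_subordinator] in auto)

text \<open>Hard to see from the negative binomial sum, but immediate from the representation as an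
  expectation: \<Psi> and the paths of \<open>G\<close> are nondecreasing.\<close>

lemma tail_Suc_ge: "tail n \<le> tail (Suc n)"
  unfolding expectation_Psi_G[symmetric]
  by (intro integral_mono integrable_Psi_G Psi_mono)
    (auto intro: subordinator_nonneg[OF G_subordinator] subordinator_mono[OF G_subordinator])

lemma tail_nonneg: "0 \<le> tail n"
  unfolding expectation_Psi_G[symmetric]
  by (intro integral_nonneg_AE AE_I2 Psi_bounds subordinator_nonneg[OF G_subordinator]) auto

lemma tail_le_1: "tail n \<le> 1"
  using pos unfolding tail_def
  by (simp add: sum_nonneg neg_binomial_weight_nonneg)

lemma abs_tail_le_1: "\<bar>tail n\<bar> \<le> 1"
  using tail_nonneg tail_le_1 by simp

text \<open>With shape parameter 0 all mass sits at j = 0, and k \<ge> 1 places that level in the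
  subtracted sum. This zero removes the boundary term in the later summation by parts.\<close>

lemma tail_0: "tail 0 = 0"
proof -
  have "(\<Sum>j<k. neg_binomial_weight 0 (lam\<^sub>1 / (lam\<^sub>1 + \<beta>)) j) = (\<Sum>j<k. if j = 0 then 1 else 0)"
    using pos by (intro sum.cong) (auto simp: neg_binomial_weight_def pochhammer_0_left field_simps)
  then show ?thesis
    using pos by (simp add: tail_def)
qed

section \<open>The law of the composed process and the passage event\<close>

lemma
  assumes "0 \<le> s"
  shows Y_measurable: "random_variable (count_space UNIV) (time_change N\<^sub>1 G\<^sub>N s)"
    and prob_Y_ge_eq_expectation:
      "prob {\<omega> \<in> space M. k \<le> time_change N\<^sub>1 G\<^sub>N s \<omega>} = expectation (\<lambda>\<omega>. \<Psi> (G\<^sub>N s \<omega>))"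
proof -
  have indep: "indep_var borel (\<lambda>\<omega>. real (N\<^sub>1 t \<omega>)) borel (G\<^sub>N s)" if "0 \<le> t" for t
    using indep_processes_marginal[OF indep_GN_N1 assms that]
    unfolding G\<^sub>N_def by (rule indep_var_swap)
  note right = poisson_process_right_locally_constant[OF N\<^sub>1]
  show "random_variable (count_space UNIV) (time_change N\<^sub>1 G\<^sub>N s)"
    unfolding time_change_def
    by (rule measurable_right_continuous_time_change[OF GN_measurable[OF assms] GN_nonneg right indep])
  show "prob {\<omega> \<in> space M. k \<le> time_change N\<^sub>1 G\<^sub>N s \<omega>} = expectation (\<lambda>\<omega>. \<Psi> (G\<^sub>N s \<omega>))"
    using prob_indep_time_change[OF GN_measurable[OF assms] GN_nonneg right indep continuous_on_Psi, of "{k..}"]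
    by (simp add: time_change_def Psi_eq_prob)
qed

lemma prob_Y_ge:
  assumes "0 \<le> s"
  shows "prob {\<omega> \<in> space M. k \<le> time_change N\<^sub>1 G\<^sub>N s \<omega>} = cdf_T s"
proof -
  have "(\<lambda>n. poisson_weight (lam * s) n * tail n) sums expectation (\<lambda>\<omega>. \<Psi> (G\<^sub>N s \<omega>))"
    unfolding expectation_Psi_G[symmetric]
    by (rule expectation_GN_sums[where B = 1]) (use assms Psi_bounds in auto)
  then show ?thesis
    by (simp add: prob_Y_ge_eq_expectation[OF assms] cdf_T_def sums_iff)
qed

lemma T_le_iff:
  assumes "\<omega> \<in> space M" "0 \<le> t"
  shows "T \<omega> \<le> ereal t \<longleftrightarrow> k \<le> time_change N\<^sub>1 G\<^sub>N t \<omega>"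
  unfolding T_def
proof (rule first_passage_time_le_iff[OF assms(2)])
  show "time_change N\<^sub>1 G\<^sub>N s \<omega> \<le> time_change N\<^sub>1 G\<^sub>N s' \<omega>" if "0 \<le> s" "s \<le> s'" for s s'
  proof -
    have "G\<^sub>N s \<omega> \<le> G\<^sub>N s' \<omega>"
      using subordinator_mono[OF G_subordinator assms(1)] subordinator_mono[OF N_subordinator assms(1) that]
      by (simp add: GN_eq)
    then show ?thesis
      using subordinator_mono[OF N1_subordinator assms(1)] GN_nonneg[OF assms(1)]
      by (simp add: time_change_def)
  qed
  \<comment> \<open>The constancy is inherited from \<open>N\<close>: as long as \<open>N\<close>
    does not move, neither does the time at which \<open>N\<^sub>1\<close> is read.\<close>
  show "\<forall>\<^sub>F s in at_right t. time_change N\<^sub>1 G\<^sub>N s \<omega> = time_change N\<^sub>1 G\<^sub>N t \<omega>"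
    using poisson_process_right_locally_constant[OF N assms]
    by (rule eventually_mono) (simp add: time_change_def GN_eq)
qed

section \<open>Boundary values of the distribution function and finiteness of the passage
  time\<close>

lemma cdf_T_0: "cdf_T 0 = 0"
proof -
  have "{\<omega> \<in> space M. k \<le> time_change N\<^sub>1 G\<^sub>N 0 \<omega>} = {}"
    using subordinator_zero[OF N_subordinator] subordinator_zero[OF G_subordinator]
      subordinator_zero[OF N1_subordinator] pos
    by (auto simp: time_change_def GN_eq)
  then show ?thesis
    using prob_Y_ge[of 0] by (simp only: order_refl measure_empty)
qed

text \<open>\<open>1 - cdf_T s\<close> is at most a constant times the Laplace transform of
  \<open>G\<^sub>N s\<close> at half the rate of \<open>N\<^sub>1\<close>, which decays
  exponentially in s. Giving up half of the rate absorbs the powers of x in the Poisson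
  weights.\<close>

lemma cdf_T_tendsto_1: "(\<lambda>n. cdf_T (real n)) \<longlonglongrightarrow> 1"
proof -
  \<comment> \<open>\<open>r\<close> is the Laplace transform of \<open>G 1\<close> at
    \<open>lam\<^sub>1 / 2\<close>, and \<open>C\<close> collects the factors 2^j that arise from
    halving the Poisson mean.\<close>
  define r where "r = (1 + lam\<^sub>1 / 2 / \<beta>) powr (- \<alpha>)"
  define C where "C = (\<Sum>j<k. 2 ^ j :: real)"
  have r: "r < 1"
    using pos powr_less_mono[of "- \<alpha>" 0 "1 + lam\<^sub>1 / 2 / \<beta>"] by (simp add: r_def add_pos_pos[THEN less_imp_neq, symmetric])
  have tail_bound: "1 - \<Psi> x \<le> C * exp (- (lam\<^sub>1 / 2) * x)" if "0 \<le> x" for x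
  proof -
    have "poisson_weight (lam\<^sub>1 * x) j \<le> 2 ^ j * exp (- (lam\<^sub>1 / 2) * x)" for j
    proof -
      have "poisson_weight (lam\<^sub>1 * x / 2) j * (2 ^ j * exp (- (lam\<^sub>1 / 2) * x)) \<le>
          1 * (2 ^ j * exp (- (lam\<^sub>1 / 2) * x))"
        using that pos by (intro mult_right_mono poisson_weight_le_1) auto
      also have "poisson_weight (lam\<^sub>1 * x / 2) j * (2 ^ j * exp (- (lam\<^sub>1 / 2) * x)) = poisson_weight (lam\<^sub>1 * x) j"
        by (simp add: poisson_weight_def power_divide flip: exp_add)
      finally show ?thesis
        by simp
    qed
    then show ?thesis
      unfolding \<Psi>_def C_def sum_distrib_right by (simp add: sum_mono)
  qed
  have bound: "1 - cdf_T s \<le> C * exp (- (1 - r) * (lam * s))" if s: "0 \<le> s" for s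
  proof -
    note [measurable] = GN_measurable[OF s]
    have "(\<lambda>n. poisson_weight (lam * s) n * expectation (\<lambda>\<omega>. exp (- (lam\<^sub>1 / 2) * G (real n) \<omega>))) sums
        expectation (\<lambda>\<omega>. exp (- (lam\<^sub>1 / 2) * G\<^sub>N s \<omega>))"
      by (rule expectation_GN_sums[where B = 1 and h = "\<lambda>x. exp (- (lam\<^sub>1 / 2) * x)"]) (use pos s in auto)
    moreover have "expectation (\<lambda>\<omega>. exp (- (lam\<^sub>1 / 2) * G (real n) \<omega>)) = r ^ n" for n
    proof -
      have "(1 + lam\<^sub>1 / 2 / \<beta>) powr (- (\<alpha> * real n)) = r powr real n"
        by (simp add: r_def powr_powr)
      also have "\<dots> = r ^ n"
        using pos by (intro powr_realpow) (simp add: r_def add_pos_pos[THEN less_imp_neq, symmetric])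
      finally show ?thesis
        using pos by (subst G_laplace) simp_all
    qed
    ultimately have E: "expectation (\<lambda>\<omega>. exp (- (lam\<^sub>1 / 2) * G\<^sub>N s \<omega>)) = exp (- (1 - r) * (lam * s))"
      using poisson_weight_generating_function[of "lam * s" r] by (simp add: sums_iff)
    have int: "integrable M (\<lambda>\<omega>. exp (- (lam\<^sub>1 / 2) * G\<^sub>N s \<omega>))" "integrable M (\<lambda>\<omega>. \<Psi> (G\<^sub>N s \<omega>))"
      using pos GN_nonneg Psi_bounds by (auto intro!: integrable_const_bound[where B = 1])
    have "1 - cdf_T s = expectation (\<lambda>\<omega>. 1 - \<Psi> (G\<^sub>N s \<omega>))"
      using prob_Y_ge[OF s] prob_Y_ge_eq_expectation[OF s] int by (simp add: prob_space)
    also have "\<dots> \<le> expectation (\<lambda>\<omega>. C * exp (- (lam\<^sub>1 / 2) * G\<^sub>N s \<omega>))"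
      using int by (intro integral_mono tail_bound GN_nonneg) auto
    finally show ?thesis
      using E by simp
  qed
  have "(\<lambda>n. 1 - cdf_T (real n)) \<longlonglongrightarrow> 0"
  proof (rule tendsto_sandwich)
    show "\<forall>\<^sub>F n in sequentially. 0 \<le> 1 - cdf_T (real n)"
      by (intro always_eventually) (simp add: prob_Y_ge[symmetric])
    show "\<forall>\<^sub>F n in sequentially. 1 - cdf_T (real n) \<le> C * exp (- (1 - r) * lam) ^ n"
    proof (intro always_eventually allI)
      show "1 - cdf_T (real n) \<le> C * exp (- (1 - r) * lam) ^ n" for n
        using bound[of "real n"] unfolding exp_of_nat_mult[symmetric] by (simp add: mult_ac)
    qed
    have "exp (- (1 - r) * lam) < 1"
      using r pos by (simp add: mult_neg_pos)
    then have "(\<lambda>n. C * exp (- (1 - r) * lam) ^ n) \<longlonglongrightarrow> C * 0"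
      by (intro tendsto_mult tendsto_const LIMSEQ_power_zero) simp
    then show "(\<lambda>n. C * exp (- (1 - r) * lam) ^ n) \<longlonglongrightarrow> 0"
      by simp
  qed simp
  from tendsto_diff[OF tendsto_const[of 1] this] show ?thesis
    by simp
qed

text \<open>The event of missing the level at every integer time lies in events of probability
  \<open>1 - cdf_T n\<close> for all n, hence is null.\<close>

lemma AE_T_finite: "AE \<omega> in M. T \<omega> < \<infinity>"
proof -
  define E where "E = {\<omega> \<in> space M. \<forall>n. \<not> k \<le> time_change N\<^sub>1 G\<^sub>N (real n) \<omega>}"
  note [measurable] = Y_measurable[of "real n" for n]
  have E [measurable]: "E \<in> events"
    unfolding E_def by measurable
  have "prob E \<le> 1 - cdf_T (real n)" for n
  proof -
    have "prob E \<le> prob (space M - {\<omega> \<in> space M. k \<le> time_change N\<^sub>1 G\<^sub>N (real n) \<omega>})"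
      by (rule finite_measure_mono) (auto simp: E_def)
    also have "\<dots> = 1 - cdf_T (real n)"
      by (subst prob_compl) (simp_all add: prob_Y_ge)
    finally show ?thesis .
  qed
  moreover have "(\<lambda>n. 1 - cdf_T (real n)) \<longlonglongrightarrow> 1 - 1"
    by (intro tendsto_diff tendsto_const cdf_T_tendsto_1)
  ultimately have "prob E \<le> 0"
    by (intro LIMSEQ_le_const[of _ "0"]) auto
  then have "E \<in> null_sets M"
    using E by (auto simp: null_sets_def emeasure_eq_measure measure_le_0_iff)
  from AE_not_in[OF this] show ?thesis
  proof (rule AE_mp, intro AE_I2 impI)
    fix \<omega> assume "\<omega> \<in> space M" "\<omega> \<notin> E"
    then obtain n :: nat where "T \<omega> \<le> ereal (real n)"
      by (auto simp: E_def T_le_iff)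
    then show "T \<omega> < \<infinity>"
      by (auto intro: le_less_trans)
  qed
qed

section \<open>The density and the law of the passage time\<close>

lemma DERIV_cdf_T: "(cdf_T has_real_derivative pdf_T s) (at s)"
proof -
  have "((\<lambda>s. \<Sum>n. poisson_weight (lam * s) n * tail n) has_real_derivative
      (\<Sum>n. poisson_weight (lam * s) n * (tail (Suc n) - tail n)) * lam) (at s)"
    by (rule DERIV_chain2[OF has_real_derivative_poisson_mean[of tail 1, OF abs_tail_le_1]])
      (auto intro!: derivative_eq_intros)
  then show ?thesis
    by (simp add: cdf_T_def[abs_def] pdf_T_def mult.commute)
qed

lemma tail_diff_bound: "\<bar>tail (Suc n) - tail n\<bar> \<le> 1"
  using tail_nonneg[of n] tail_le_1[of "Suc n"] tail_Suc_ge[of n] by simp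

lemma pdf_T_nonneg: "0 \<le> s \<Longrightarrow> 0 \<le> pdf_T s"
  unfolding pdf_T_def using pos tail_Suc_ge
  by (intro mult_nonneg_nonneg suminf_nonneg summable_poisson_weight_mult[where B = 1] tail_diff_bound)
    (auto intro!: poisson_weight_nonneg)

lemma borel_measurable_pdf_T [measurable]: "pdf_T \<in> borel_measurable borel"
  unfolding pdf_T_def[abs_def] poisson_weight_def by measurable

lemma T_measurable: "random_variable borel (\<lambda>\<omega>. real_of_ereal (T \<omega>))"
proof (rule borel_measurable_iff_le[THEN iffD2], intro allI)
  fix x :: real
  have T_nonneg: "0 \<le> T \<omega>" for \<omega>
    unfolding T_def by (rule first_passage_time_nonneg)
  show "{\<omega> \<in> space M. real_of_ereal (T \<omega>) \<le> x} \<in> events"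
  proof (cases "0 \<le> x")
    case True
    note [measurable] = Y_measurable[of "real n" for n] Y_measurable[OF True]
    \<comment> \<open>\<open>real_of_ereal\<close> sends \<infinity> to 0, so paths that never reach
      the level also satisfy the inequality. The second disjunct expresses this case by countably
      many events.\<close>
    have "(real_of_ereal (T \<omega>) \<le> x) \<longleftrightarrow>
        k \<le> time_change N\<^sub>1 G\<^sub>N x \<omega> \<or> (\<forall>n. \<not> k \<le> time_change N\<^sub>1 G\<^sub>N (real n) \<omega>)"
      if "\<omega> \<in> space M" for \<omega>
    proof -
      have "(\<forall>n. \<not> T \<omega> \<le> ereal (real n)) \<longleftrightarrow> T \<omega> = \<infinity>"
        using T_nonneg[of \<omega>] real_arch_simple by (cases "T \<omega>") auto
      moreover have "(real_of_ereal (T \<omega>) \<le> x) \<longleftrightarrow> T \<omega> \<le> ereal x \<or> T \<omega> = \<infinity>"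
        using True T_nonneg[of \<omega>] by (cases "T \<omega>") auto
      ultimately show ?thesis
        using T_le_iff[OF that] True by simp
    qed
    then have "{\<omega> \<in> space M. real_of_ereal (T \<omega>) \<le> x} =
        {\<omega> \<in> space M. k \<le> time_change N\<^sub>1 G\<^sub>N x \<omega> \<or> (\<forall>n. \<not> k \<le> time_change N\<^sub>1 G\<^sub>N (real n) \<omega>)}"
      by blast
    also have "\<dots> \<in> events"
      by measurable
    finally show ?thesis .
  next
    case False
    then have "{\<omega> \<in> space M. real_of_ereal (T \<omega>) \<le> x} = {}"
      using real_of_ereal_pos[OF T_nonneg] by (auto intro: order_trans)
    then show ?thesis
      by (simp only: sets.empty_sets)
  qed
qed

lemma distributed_T: "distributed M lborel (\<lambda>\<omega>. real_of_ereal (T \<omega>)) (\<lambda>s. ennreal (if s > 0 then pdf_T s else 0))"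
proof (rule distributedI_borel_atMost[where g = "\<lambda>a. if 0 \<le> a then cdf_T a else 0"])
  show "AE s in lborel. 0 \<le> (if s > 0 then pdf_T s else 0)"
    by (simp add: pdf_T_nonneg)
next
  fix a :: real
  show "(\<integral>\<^sup>+s. ennreal ((if s > 0 then pdf_T s else 0) * indicator {..a} s) \<partial>lborel) =
      ennreal (if 0 \<le> a then cdf_T a else 0)"
  proof (cases "0 \<le> a")
    case True
    \<comment> \<open>The stated density is 0 at s = 0 while \<open>pdf_T\<close> need not vanish
      there; a single point is a null set. The derivative of \<open>cdf_T\<close> exists at every
      real point, so the closed interval can include 0.\<close>
    have "(\<integral>\<^sup>+s. ennreal ((if s > 0 then pdf_T s else 0) * indicator {..a} s) \<partial>lborel) =
        (\<integral>\<^sup>+s. ennreal (pdf_T s) * indicator {0..a} s \<partial>lborel)"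
      by (rule nn_integral_cong_AE, rule AE_mp[OF AE_lborel_singleton[of 0]])
        (auto simp: indicator_def intro!: AE_I2)
    also have "\<dots> = ennreal (cdf_T a - cdf_T 0)"
      using True by (intro nn_integral_FTC_Icc DERIV_cdf_T) (auto simp: pdf_T_nonneg)
    finally show ?thesis
      using True by (simp add: cdf_T_0)
  next
    case False
    then have "(if s > 0 then pdf_T s else 0) * indicator {..a} s = 0" for s
      by (auto simp: indicator_def)
    then show ?thesis
      using False by (simp only: if_False ennreal_0 nn_integral_const mult_zero_left)
  qed
  show "emeasure M {\<omega> \<in> space M. real_of_ereal (T \<omega>) \<le> a} = ennreal (if 0 \<le> a then cdf_T a else 0)"
  proof (cases "0 \<le> a")
    case True
    note [measurable] = Y_measurable[OF True] T_measurable
    \<comment> \<open>The two events may differ where \<open>T\<close> is infinite, since such paths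
      are sent to 0; this happens with probability 0.\<close>
    have "emeasure M {\<omega> \<in> space M. real_of_ereal (T \<omega>) \<le> a} =
        emeasure M {\<omega> \<in> space M. k \<le> time_change N\<^sub>1 G\<^sub>N a \<omega>}"
    proof (rule emeasure_eq_AE)
      show "AE \<omega> in M. \<omega> \<in> {\<omega> \<in> space M. real_of_ereal (T \<omega>) \<le> a} \<longleftrightarrow>
          \<omega> \<in> {\<omega> \<in> space M. k \<le> time_change N\<^sub>1 G\<^sub>N a \<omega>}"
        using AE_T_finite
      proof (rule AE_mp, intro AE_I2 impI)
        fix \<omega> assume \<omega>: "\<omega> \<in> space M" and fin: "T \<omega> < \<infinity>"
        have "0 \<le> T \<omega>"
          unfolding T_def by (rule first_passage_time_nonneg)
        then have "(real_of_ereal (T \<omega>) \<le> a) \<longleftrightarrow> T \<omega> \<le> ereal a"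
          using fin by (cases "T \<omega>") auto
        then show "\<omega> \<in> {\<omega> \<in> space M. real_of_ereal (T \<omega>) \<le> a} \<longleftrightarrow>
            \<omega> \<in> {\<omega> \<in> space M. k \<le> time_change N\<^sub>1 G\<^sub>N a \<omega>}"
          using \<omega> by (simp add: T_le_iff[OF \<omega> True])
      qed
    qed measurable
    then show ?thesis
      using True by (simp add: emeasure_eq_measure prob_Y_ge)
  next
    case False
    have "0 \<le> real_of_ereal (T \<omega>)" for \<omega>
      by (simp add: T_def real_of_ereal_pos first_passage_time_nonneg)
    then have "\<not> real_of_ereal (T \<omega>) \<le> a" for \<omega>
      using False by (meson order_trans)
    then show ?thesis
      using False by simp
  qed
qed (use T_measurable in auto)

end

subsection \<open>The double series and the Mittag-Leffler form\<close>

context poisson_gamma_passage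
begin

text \<open>This and the next two definitions name the summands \<open>a\<close>, \<open>b\<close>
  and \<open>c\<close> of the theorem. Only n \<ge> 1 is summed, so the truncated n - 1 is an honest
  exponent.\<close>

definition jump_term :: "nat \<Rightarrow> real \<Rightarrow> nat \<Rightarrow> real" where
  "jump_term j s n = s ^ (n - 1) * (real n - lam * s) * (lam * \<beta> powr \<alpha> / (lam\<^sub>1 + \<beta>) powr \<alpha>) ^ n
     * (Gamma (\<alpha> * real n + real j) / (fact n * Gamma (\<alpha> * real n)))"

definition level_term :: "real \<Rightarrow> nat \<Rightarrow> real" where
  "level_term s j = (lam\<^sub>1 / (lam\<^sub>1 + \<beta>)) ^ j * (1 / fact j) * (\<Sum>\<^sub>\<infinity>n\<in>{1..}. jump_term j s n)"

definition mittag_leffler_term :: "real \<Rightarrow> nat \<Rightarrow> real" where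
  "mittag_leffler_term s j = lam\<^sub>1 ^ j / (lam\<^sub>1 + \<beta>) ^ j
     * (mittag_leffler3 1 1 (real j + 1) (lam * \<beta> * s / (lam\<^sub>1 + \<beta>))
        - lam * s * mittag_leffler3 1 2 (real j + 1) (lam * \<beta> * s / (lam\<^sub>1 + \<beta>)))"

text \<open>For n \<ge> 1 this is the derivative of the n-th Poisson weight with respect to the
  mean, taken at \<open>lam * s\<close>. It is the coefficient of \<open>tail n\<close> after
  summation by parts.\<close>

definition weight_diff :: "real \<Rightarrow> nat \<Rightarrow> real" where
  "weight_diff s n = poisson_weight (lam * s) (n - 1) - poisson_weight (lam * s) n"

text \<open>Three factors are matched separately: the Pochhammer symbol with the Gamma quotient,
  which is legitimate because n \<ge> 1 keeps \<alpha> n off the poles; the power of 1 - q with the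
  power of \<beta>; and the weight difference with n - \<lambda> s, by 1 / (n-1)! = n / n!.\<close>

lemma jump_term_eq:
  assumes n: "1 \<le> n"
  shows "lam * (weight_diff s n * neg_binomial_weight (\<alpha> * real n) (lam\<^sub>1 / (lam\<^sub>1 + \<beta>)) j) =
    exp (- lam * s) * ((lam\<^sub>1 / (lam\<^sub>1 + \<beta>)) ^ j * (1 / fact j)) * jump_term j s n"
proof -
  obtain m where m: "n = Suc m"
    using n by (cases n) auto
  have "pochhammer (\<alpha> * real n) j = Gamma (\<alpha> * real n + real j) / Gamma (\<alpha> * real n)"
    proof (rule pochhammer_Gamma)
    have "0 < \<alpha> * real n"
      using pos n by simp
    then show "\<alpha> * real n \<notin> \<int>\<^sub>\<le>\<^sub>0"
      using nonpos_Ints_nonpos[of "\<alpha> * real n"] by linarith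
  qed
  moreover have "(1 - lam\<^sub>1 / (lam\<^sub>1 + \<beta>)) powr (\<alpha> * real n) = (\<beta> powr \<alpha> / (lam\<^sub>1 + \<beta>) powr \<alpha>) ^ n"
  proof -
    have "1 - lam\<^sub>1 / (lam\<^sub>1 + \<beta>) = \<beta> / (lam\<^sub>1 + \<beta>)"
      using pos by (simp add: field_simps)
    then have "(1 - lam\<^sub>1 / (lam\<^sub>1 + \<beta>)) powr (\<alpha> * real n) = ((\<beta> / (lam\<^sub>1 + \<beta>)) powr \<alpha>) powr real n"
      by (simp add: powr_powr)
    also have "\<dots> = ((\<beta> / (lam\<^sub>1 + \<beta>)) powr \<alpha>) ^ n"
      using pos by (intro powr_realpow) simp
    finally show ?thesis
      using pos by (simp add: powr_divide)
  qed
  moreover have "lam * weight_diff s n = exp (- lam * s) * (s ^ (n - 1) * (real n - lam * s) * lam ^ n / fact n)"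
  proof -
    have "(lam * s) ^ m / fact m = real n * ((lam * s) ^ m / fact n)"
      by (simp add: m del: of_nat_Suc)
    then show ?thesis
      unfolding weight_diff_def poisson_weight_def
      by (simp add: m power_mult_distrib diff_divide_distrib left_diff_distrib right_diff_distrib mult_ac
          del: of_nat_Suc fact_Suc)
  qed
  moreover have "(lam * \<beta> powr \<alpha> / (lam\<^sub>1 + \<beta>) powr \<alpha>) ^ n = lam ^ n * (\<beta> powr \<alpha> / (lam\<^sub>1 + \<beta>) powr \<alpha>) ^ n"
    by (simp flip: power_mult_distrib)
  ultimately show ?thesis
    unfolding neg_binomial_weight_def jump_term_def mult.assoc[symmetric, of lam] by (simp add: ac_simps)
qed

lemma infsum_atLeast_1: "infsum g {1..} = infsum (\<lambda>n. g (Suc n)) UNIV"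
  and summable_on_atLeast_1: "g summable_on {1..} \<longleftrightarrow> (\<lambda>n. g (Suc n)) summable_on UNIV"
  for g :: "nat \<Rightarrow> real"
proof -
  have "{1..} = range Suc"
    by (auto simp: image_iff Suc_le_eq gr0_conv_Suc)
  then show "infsum g {1..} = infsum (\<lambda>n. g (Suc n)) UNIV"
    "g summable_on {1..} \<longleftrightarrow> (\<lambda>n. g (Suc n)) summable_on UNIV"
    by (simp_all add: infsum_reindex summable_on_reindex comp_def)
qed

lemma neg_binomial_tail_has_sum:
  "(neg_binomial_weight (\<alpha> * real n) (lam\<^sub>1 / (lam\<^sub>1 + \<beta>)) has_sum tail n) {k..}"
proof -
  let ?m = "neg_binomial_weight (\<alpha> * real n) (lam\<^sub>1 / (lam\<^sub>1 + \<beta>))"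
  have "(?m has_sum 1) UNIV"
    using pos by (intro sums_nonneg_imp_has_sum neg_binomial_weight_sums neg_binomial_weight_nonneg) auto
  moreover have "(?m has_sum (\<Sum>j<k. ?m j)) {..<k}"
    by (rule has_sum_finite) simp
  ultimately have "(?m has_sum (1 - (\<Sum>j<k. ?m j))) (UNIV - {..<k})"
    by (rule has_sum_Diff) simp
  then show ?thesis
    by (simp add: tail_def Compl_eq_Diff_UNIV[symmetric])
qed

context
  fixes s :: real
  assumes s: "0 < s"
begin

lemma abs_summable_weight_diff: "(\<lambda>n. \<bar>weight_diff s n\<bar>) summable_on {1..}"
proof -
  have nonneg: "0 \<le> poisson_weight (lam * s) n" for n
    using s pos by (simp add: poisson_weight_nonneg)
  have "summable (\<lambda>n. \<bar>weight_diff s (Suc n)\<bar>)"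
  proof (rule summable_comparison_test')
    have "summable (poisson_weight (lam * s))"
      using poisson_weight_sums by (rule sums_summable)
    then show "summable (\<lambda>n. poisson_weight (lam * s) n + poisson_weight (lam * s) (Suc n))"
      by (intro summable_add) (simp_all add: summable_Suc_iff)
    show "norm \<bar>weight_diff s (Suc n)\<bar> \<le> poisson_weight (lam * s) n + poisson_weight (lam * s) (Suc n)" for n
      using nonneg[of n] nonneg[of "Suc n"] by (simp add: weight_diff_def)
  qed
  then show ?thesis
    unfolding summable_on_atLeast_1 by (simp add: summable_on_UNIV_nonneg_real_iff)
qed

text \<open>Up to constants the double series pairs weight differences, absolutely summable over n,
  with negative binomial weights whose mass over j \<ge> k is \<open>tail n\<close> and so at most
  1. This is the setting of \<open>summable_on_product_weighted\<close>; summation by parts leads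
  from the collapsed sum to \<open>pdf_T\<close>.\<close>

lemma
  shows summable_jump_term: "k \<le> j \<Longrightarrow> jump_term j s summable_on {1..}"
    and summable_level_term: "level_term s summable_on {k..}"
    and pdf_T_eq: "exp (- lam * s) * (\<Sum>\<^sub>\<infinity>j\<in>{k..}. level_term s j) = pdf_T s"
proof -
  let ?q = "lam\<^sub>1 / (lam\<^sub>1 + \<beta>)"
  let ?m = "\<lambda>n j. neg_binomial_weight (\<alpha> * real n) ?q j"
  \<comment> \<open>The constant that remains when \<open>jump_term_eq\<close> is solved for the
    summand of the theorem.\<close>
  define e where "e = lam / exp (- lam * s)"
  have e: "e \<noteq> 0"
    using pos by (simp add: e_def)
  note product = summable_on_product_weighted[where d = "weight_diff s" and I = "{1..}" and J = "{k..}" and m = ?m and w = tail,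
      OF abs_summable_weight_diff _ neg_binomial_tail_has_sum tail_le_1]
  have m: "0 \<le> ?m n j" for n j
    using pos by (intro neg_binomial_weight_nonneg) auto
  have jump: "?q ^ j * (1 / fact j) * jump_term j s n = e * (weight_diff s n * ?m n j)" if "n \<in> {1..}" for n j
    using jump_term_eq[of n s j] that by (simp add: e_def field_simps)
  show "jump_term j s summable_on {1..}" if "k \<le> j"
  proof -
    have "(\<lambda>n. e * (weight_diff s n * ?m n j)) summable_on {1..}"
      using that m by (intro summable_on_cmult_right product(1)) auto
    then have "(\<lambda>n. ?q ^ j * (1 / fact j) * jump_term j s n) summable_on {1..}"
      by (rule summable_on_cong[THEN iffD1, rotated]) (rule jump[symmetric])
    then show ?thesis
      using pos by (subst (asm) summable_on_cmult_right') auto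
  qed
  have level: "level_term s j = e * (\<Sum>\<^sub>\<infinity>n\<in>{1..}. weight_diff s n * ?m n j)" for j
  proof -
    have "level_term s j = (\<Sum>\<^sub>\<infinity>n\<in>{1..}. ?q ^ j * (1 / fact j) * jump_term j s n)"
      unfolding level_term_def by (rule infsum_cmult_right'[symmetric])
    also have "\<dots> = (\<Sum>\<^sub>\<infinity>n\<in>{1..}. e * (weight_diff s n * ?m n j))"
      by (intro infsum_cong jump)
    finally show ?thesis
      by (simp add: infsum_cmult_right')
  qed
  show "level_term s summable_on {k..}"
    unfolding level[abs_def] using m by (intro summable_on_cmult_right product(2))
  have "(\<lambda>n. \<bar>weight_diff s n * tail n\<bar>) summable_on {1..}"
    using abs_summable_weight_diff
    by (rule summable_on_comparison_test) (auto simp: abs_mult intro!: mult_left_le abs_tail_le_1)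
  then have "(\<lambda>n. weight_diff s n * tail n) summable_on {1..}"
    by (rule Infinite_Sum.abs_summable_summable[OF summable_on_cong[THEN iffD1, rotated]]) simp
  then have "((\<lambda>n. weight_diff s (Suc n) * tail (Suc n)) has_sum (\<Sum>\<^sub>\<infinity>n\<in>{1..}. weight_diff s n * tail n)) UNIV"
    unfolding summable_on_atLeast_1 infsum_atLeast_1 by (rule has_sum_infsum)
  then have "(\<lambda>n. weight_diff s (Suc n) * tail (Suc n)) sums (\<Sum>\<^sub>\<infinity>n\<in>{1..}. weight_diff s n * tail n)"
    by (rule has_sum_imp_sums)
  moreover have "(\<lambda>n. weight_diff s (Suc n) * tail (Suc n)) sums
      (\<Sum>n. poisson_weight (lam * s) n * (tail (Suc n) - tail n))"
  proof -
    let ?p = "poisson_weight (lam * s)"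
    have sm: "summable (\<lambda>n. ?p n * tail (Suc n))" "summable (\<lambda>n. ?p n * tail n)"
      by (intro summable_poisson_weight_mult[where B = 1] abs_tail_le_1)+
    \<comment> \<open>The index shift loses the term for n = 0, which vanishes by
      \<open>tail_0\<close>; no boundary term is left.\<close>
    have "(\<lambda>n. ?p (Suc n) * tail (Suc n)) sums (\<Sum>n. ?p n * tail n)"
      using summable_sums[OF sm(2)] by (subst sums_Suc_iff) (simp add: tail_0)
    with summable_sums[OF sm(1)]
    have "(\<lambda>n. ?p n * tail (Suc n) - ?p (Suc n) * tail (Suc n)) sums
        ((\<Sum>n. ?p n * tail (Suc n)) - (\<Sum>n. ?p n * tail n))"
      by (rule sums_diff)
    then show ?thesis
      by (simp add: weight_diff_def left_diff_distrib right_diff_distrib suminf_diff[OF sm])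
  qed
  ultimately have *: "(\<Sum>\<^sub>\<infinity>n\<in>{1..}. weight_diff s n * tail n) = (\<Sum>n. poisson_weight (lam * s) n * (tail (Suc n) - tail n))"
    by (rule sums_unique2)
  have "(\<Sum>\<^sub>\<infinity>j\<in>{k..}. level_term s j) = e * (\<Sum>\<^sub>\<infinity>j\<in>{k..}. \<Sum>\<^sub>\<infinity>n\<in>{1..}. weight_diff s n * ?m n j)"
    unfolding level by (rule infsum_cmult_right')
  also have "(\<Sum>\<^sub>\<infinity>j\<in>{k..}. \<Sum>\<^sub>\<infinity>n\<in>{1..}. weight_diff s n * ?m n j) = (\<Sum>\<^sub>\<infinity>n\<in>{1..}. weight_diff s n * tail n)"
    using m by (intro product(3))
  finally show "exp (- lam * s) * (\<Sum>\<^sub>\<infinity>j\<in>{k..}. level_term s j) = pdf_T s"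
    unfolding * by (simp add: pdf_T_def e_def)
qed

text \<open>With \<alpha> = 1 and n = m + 1 the Gamma quotient becomes (j + m)! / m!. Splitting n -
  \<lambda> s then yields two factorial series, with second Mittag-Leffler parameter 1 and
  2.\<close>

lemma level_term_eq_mittag_leffler_term:
  assumes "\<alpha> = 1" "k \<le> j"
  shows "level_term s j = lam * \<beta> / (lam\<^sub>1 + \<beta>) * mittag_leffler_term s j"
proof -
  define C where "C = lam * \<beta> / (lam\<^sub>1 + \<beta>)"
  define z where "z = C * s"
  \<comment> \<open>The Mittag-Leffler summand with second parameter i + 1 and upper parameter j +
    1, all Gamma values written as factorials.\<close>
  define t where "t i m = fact (j + m) / fact j * (z ^ m / (fact m * fact (m + i)))" for i m :: nat
  have z: "0 \<le> z"
    using pos s by (simp add: z_def C_def)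
  have Gamma_Suc: "Gamma (real m + 1) = fact m" for m
    using Gamma_fact[of m, where 'a = real] by (simp add: add.commute)
  have t_sums: "t i sums mittag_leffler3 1 (real (Suc i)) (real j + 1) z" for i
  proof -
    have "summable (t i)"
    proof (rule summable_comparison_test')
      show "summable (\<lambda>m. 2 ^ j * ((2 * z) ^ m /\<^sub>R fact m))"
        by (intro summable_mult summable_exp_generic)
      fix m :: nat
      \<comment> \<open>The factorial quotient is a binomial coefficient up to m!, hence bounded by
        2^(j+m); this leaves an exponential series in 2 * z.\<close>
      have "fact (j + m) = (fact j * fact m * real ((j + m) choose j) :: real)"
        using binomial_fact_lemma[of j "j + m"] by (metis add_diff_cancel_left' le_add1 of_nat_fact of_nat_mult)
      then have "t i m = real ((j + m) choose j) * (z ^ m / fact (m + i))"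
        by (simp add: t_def)
      also have "\<dots> \<le> 2 ^ (j + m) * (z ^ m / fact m)"
        using z binomial_le_pow2[of "j + m" j]
        by (intro mult_mono divide_left_mono fact_mono) (auto simp flip: of_nat_power)
      also have "\<dots> = 2 ^ j * ((2 * z) ^ m /\<^sub>R fact m)"
        by (simp add: power_add power_mult_distrib field_simps)
      finally show "norm (t i m) \<le> 2 ^ j * ((2 * z) ^ m /\<^sub>R fact m)"
        using z by (simp add: t_def)
    qed
    moreover have "t i = (\<lambda>m. Gamma (real j + 1 + of_nat m) / Gamma (real j + 1) *
        (z ^ m / (fact m * Gamma (1 * of_nat m + real (Suc i)))))"
    proof
      fix m
      show "t i m = Gamma (real j + 1 + of_nat m) / Gamma (real j + 1) *
        (z ^ m / (fact m * Gamma (1 * of_nat m + real (Suc i))))"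
        using Gamma_Suc[of "j + m"] Gamma_Suc[of j] Gamma_Suc[of "m + i"] by (simp add: t_def add_ac)
    qed
    ultimately show ?thesis
      unfolding mittag_leffler3_def by (simp add: summable_sums)
  qed
  have jump: "jump_term j s (Suc m) = C * fact j * (t 0 m - lam * s * t 1 m)" for m
  proof -
    have "lam * \<beta> powr 1 / (lam\<^sub>1 + \<beta>) powr 1 = C"
      unfolding C_def using pos by (simp add: powr_one)
    moreover have "Gamma (1 * real (Suc m) + real j) = fact (j + m)" "Gamma (1 * real (Suc m)) = fact m"
      using Gamma_Suc[of "j + m"] Gamma_Suc[of m] by (simp_all add: add_ac)
    ultimately have "jump_term j s (Suc m) = C * (z ^ m * (fact (j + m) / fact m) *
        ((real (Suc m) - lam * s) / fact (Suc m)))"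
      unfolding jump_term_def unfolding assms(1)
      by (simp add: z_def power_mult_distrib mult_ac del: fact_Suc of_nat_Suc)
    \<comment> \<open>The factor n cancels one factor of n! in the first part only, which is why the
      two parts have the second parameters 1 and 2.\<close>
    also have "(real (Suc m) - lam * s) / fact (Suc m) = 1 / fact m - lam * s * (1 / fact (Suc m))"
    proof -
      have "1 / fact m = real (Suc m) / fact (Suc m)"
        by (simp del: of_nat_Suc)
      then show ?thesis
        by (simp add: diff_divide_distrib del: fact_Suc of_nat_Suc)
    qed
    also have "C * (z ^ m * (fact (j + m) / fact m) * (1 / fact m - lam * s * (1 / fact (Suc m)))) =
        C * fact j * (t 0 m - lam * s * t 1 m)"
      by (simp add: t_def right_diff_distrib left_diff_distrib mult_ac del: fact_Suc)
    finally show ?thesis .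
  qed
  have "((\<lambda>m. jump_term j s (Suc m)) has_sum (\<Sum>\<^sub>\<infinity>n\<in>{1..}. jump_term j s n)) UNIV"
    using summable_jump_term[OF assms(2)]
    unfolding summable_on_atLeast_1 infsum_atLeast_1 by (rule has_sum_infsum)
  then have "(\<lambda>m. jump_term j s (Suc m)) sums (\<Sum>\<^sub>\<infinity>n\<in>{1..}. jump_term j s n)"
    by (rule has_sum_imp_sums)
  moreover have "(\<lambda>m. jump_term j s (Suc m)) sums (C * fact j *
      (mittag_leffler3 1 (real (Suc 0)) (real j + 1) z - lam * s * mittag_leffler3 1 (real (Suc 1)) (real j + 1) z))"
    unfolding jump by (intro sums_mult sums_diff t_sums)
  ultimately have "(\<Sum>\<^sub>\<infinity>n\<in>{1..}. jump_term j s n) = C * fact j *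
      (mittag_leffler3 1 (real (Suc 0)) (real j + 1) z - lam * s * mittag_leffler3 1 (real (Suc 1)) (real j + 1) z)"
    by (rule sums_unique2)
  moreover have "lam * \<beta> * s / (lam\<^sub>1 + \<beta>) = z"
    by (simp add: z_def C_def)
  ultimately show ?thesis
    unfolding level_term_def mittag_leffler_term_def by (simp add: C_def power_divide mult_ac)
qed

end

end

theorem lemma2:
  fixes M :: "'a measure"
    and N N\<^sub>1 :: "real \<Rightarrow> 'a \<Rightarrow> nat"
    and G :: "real \<Rightarrow> 'a \<Rightarrow> real"
    and lam\<^sub>1 lam \<alpha> \<beta> :: real
    and k :: nat
  defines "G\<^sub>N \<equiv> time_change G (\<lambda>t \<omega>. real (N t \<omega>))"
  defines "T \<equiv> first_passage_time (time_change N\<^sub>1 G\<^sub>N) k"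
  defines "a \<equiv> \<lambda>(j::nat) (s::real) (n::nat).
             s ^ (n - 1) * (real n - lam * s) * (lam * \<beta> powr \<alpha> / (lam\<^sub>1 + \<beta>) powr \<alpha>) ^ n
               * (Gamma (\<alpha> * real n + real j) / (fact n * Gamma (\<alpha> * real n)))"
  defines "b \<equiv> \<lambda>(s::real) (j::nat).
             (lam\<^sub>1 / (lam\<^sub>1 + \<beta>)) ^ j * (1 / fact j) * (\<Sum>\<^sub>\<infinity>n\<in>{1..}. a j s n)"
  defines "f \<equiv> \<lambda>s. exp (- lam * s) * (\<Sum>\<^sub>\<infinity>j\<in>{k..}. b s j)"
  defines "c \<equiv> \<lambda>(s::real) (j::nat).
             lam\<^sub>1 ^ j / (lam\<^sub>1 + \<beta>) ^ j
               * (mittag_leffler3 1 1 (real j + 1) (lam * \<beta> * s / (lam\<^sub>1 + \<beta>))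
                  - lam * s * mittag_leffler3 1 2 (real j + 1) (lam * \<beta> * s / (lam\<^sub>1 + \<beta>)))"
  defines "f\<^sub>E \<equiv> \<lambda>s. exp (- lam * s) * (lam * \<beta> / (lam\<^sub>1 + \<beta>)) * (\<Sum>\<^sub>\<infinity>j\<in>{k..}. c s j)"
  assumes "prob_space M"
    and "lam\<^sub>1 > 0" "lam > 0" "\<alpha> > 0" "\<beta> > 0" "k \<ge> 1"
    and "prob_space.poisson_process M lam\<^sub>1 N\<^sub>1"
    and "prob_space.poisson_process M lam N"
    and "prob_space.gamma_process M \<alpha> \<beta> G"
    and "prob_space.indep_processes M G (\<lambda>t \<omega>. real (N t \<omega>))"
    and "prob_space.indep_processes M G\<^sub>N (\<lambda>t \<omega>. real (N\<^sub>1 t \<omega>))"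
  shows "(AE \<omega> in M. T \<omega> < \<infinity>) \<and>
         (\<forall>s>0. (\<forall>j\<ge>k. a j s summable_on {1..}) \<and> b s summable_on {k..} \<and> 0 \<le> f s) \<and>
         distributed M lborel (\<lambda>\<omega>. real_of_ereal (T \<omega>)) (\<lambda>s. ennreal (if s > 0 then f s else 0)) \<and>
         (\<alpha> = 1 \<longrightarrow>
           (\<forall>s>0. c s summable_on {k..} \<and> 0 \<le> f\<^sub>E s) \<and>
           distributed M lborel (\<lambda>\<omega>. real_of_ereal (T \<omega>)) (\<lambda>s. ennreal (if s > 0 then f\<^sub>E s else 0)))"
proof -
  interpret P: poisson_gamma_passage M N N\<^sub>1 G lam\<^sub>1 lam \<alpha> \<beta> k
    using assms(8-) unfolding G\<^sub>N_def
    by (intro poisson_gamma_passage.intro poisson_gamma_passage_axioms.intro)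
  have T: "T = P.T"
    unfolding T_def G\<^sub>N_def P.T_def P.G\<^sub>N_def ..
  have a: "a = P.jump_term"
    by (intro ext) (simp add: a_def P.jump_term_def)
  have b: "b = P.level_term"
    by (intro ext) (simp add: b_def P.level_term_def a)
  have c: "c = P.mittag_leffler_term"
    by (intro ext) (simp add: c_def P.mittag_leffler_term_def)
  have f: "f s = P.pdf_T s" if "0 < s" for s
    unfolding f_def b by (rule P.pdf_T_eq[OF that])
  \<comment> \<open>Stated for any g that agrees with \<open>pdf_T\<close> at positive times, so
    that it applies to both the double series and the Mittag-Leffler form.\<close>
  have density: "distributed M lborel (\<lambda>\<omega>. real_of_ereal (T \<omega>)) (\<lambda>s. ennreal (if s > 0 then g s else 0))"
    if "\<And>s. 0 < s \<Longrightarrow> g s = P.pdf_T s" for g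
  proof -
    have "(\<lambda>s. ennreal (if s > 0 then g s else 0)) = (\<lambda>s. ennreal (if s > 0 then P.pdf_T s else 0))"
      using that by auto
    then show ?thesis
      unfolding T by (simp only: P.distributed_T)
  qed
  have exponential: "c s summable_on {k..} \<and> f\<^sub>E s = P.pdf_T s" if "\<alpha> = 1" "0 < s" for s
  proof
    have C: "lam * \<beta> / (lam\<^sub>1 + \<beta>) \<noteq> 0"
      using P.pos by simp
    have level: "b s j = lam * \<beta> / (lam\<^sub>1 + \<beta>) * c s j" if "j \<in> {k..}" for j
      unfolding b c using P.level_term_eq_mittag_leffler_term[OF \<open>0 < s\<close> \<open>\<alpha> = 1\<close>] that by simp
    have "(\<lambda>j. lam * \<beta> / (lam\<^sub>1 + \<beta>) * c s j) summable_on {k..}"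
      using P.summable_level_term[OF \<open>0 < s\<close>] unfolding b[symmetric]
      by (rule summable_on_cong[THEN iffD1, rotated]) (rule level)
    then show "c s summable_on {k..}"
      using summable_on_cmult_right'[OF C] by blast
    have "infsum (b s) {k..} = (\<Sum>\<^sub>\<infinity>j\<in>{k..}. lam * \<beta> / (lam\<^sub>1 + \<beta>) * c s j)"
      by (intro infsum_cong level)
    then have "f s = f\<^sub>E s"
      unfolding f_def f\<^sub>E_def by (simp add: infsum_cmult_right' del: times_divide_eq_left times_divide_eq_right)
    then show "f\<^sub>E s = P.pdf_T s"
      using f[OF \<open>0 < s\<close>] by simp
  qed
  show ?thesis
    using P.AE_T_finite P.summable_jump_term P.summable_level_term P.pdf_T_nonneg
    by (intro conjI impI allI density) (auto simp: T a b f exponential)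
qed

end
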